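(* Let $n\geq 1$ be an integer, $\mu\in\mathbb R$, and $\alpha,\beta\in\mathbb R$. Equip $\mathbb R^{2n+1}=\mathbb R^n\times\mathbb R^n\times\mathbb R$ with the multiplication law \[(u,v,t)\odot(\xi,\eta,\tau)=\big(u+\xi,\ v+\eta,\ t+\tau+\mu(u\cdot\eta-v\cdot\xi)\big),\qquad (\xi,\eta,\tau)^{-1}=(-\xi,-\eta,-\tau).\] Let $\mathbf V^{\alpha\beta}$ be the distribution on $\mathbb R^{2n+1}$ which agrees, for $u\neq 0$, $v\neq0$, $t\neq 0$, with the function \[\mathbf V^{\alpha\beta}(u,v,t)=|u|^{\alpha-n}|v|^{\alpha-n}|t|^{\beta-1}\left[\frac{|u||v|}{|t|}+\frac{|t|}{|u||v|}\right]^{-\rho},\qquad \rho=\frac{|\alpha-n\beta|}{n+1},\] and define \[\mathbf I_{\alpha\beta}f(u,v,t)=\iiint_{\mathbb R^{2n+1}} f(\xi,\eta,\tau)\,\mathbf V^{\alpha\beta}\big[(u,v,t)\odot(\xi,\eta,\tau)^{-1}\big]\,d\xi\,d\eta\,d\tau .\] Let $1<p<q<\infty$. Then there is a constant $\mathfrak B_{p\,q}>0$ such that \[\|\mathbf I_{\alpha\beta}f\|_{L^q(\mathbb R^{2n+1})}\leq \mathfrak B_{p\,q}\,\|f\|_{L^p(\mathbb R^{2n+1})}\quad\text{for all } f\in L^p(\mathbb R^{2n+1})\] if and only if $\dfrac{\alpha+\beta}{n+1}=\dfrac1p-\dfrac1q$.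
   Context: Here $|\cdot|$ denotes the Euclidean norm on $\mathbb R^n$ (absolute value on $\mathbb R$), and $u\cdot\eta$ the Euclidean inner product on $\mathbb R^n$. The constant $\mathfrak B_{p\,q}$ may depend on $p,q$ (and the fixed data $n,\alpha,\beta,\mu$) but not on $f$. *)

theory Defs
  imports "HOL-Analysis.Analysis"
begin

type_synonym 'n heis = "(real^'n) \<times> (real^'n) \<times> real"

definition hmul :: "real \<Rightarrow> 'n::finite heis \<Rightarrow> 'n heis \<Rightarrow> 'n heis" where
  "hmul \<mu> x y = (case x of (u, v, t) \<Rightarrow> case y of (\<xi>, \<eta>, \<tau>) \<Rightarrow>
      (u + \<xi>, v + \<eta>, t + \<tau> + \<mu> * (u \<bullet> \<eta> - v \<bullet> \<xi>)))"

definition hinv :: "'n::finite heis \<Rightarrow> 'n heis" where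
  "hinv y = (case y of (\<xi>, \<eta>, \<tau>) \<Rightarrow> (-\<xi>, -\<eta>, -\<tau>))"

text \<open>The kernel V^{alpha beta}; off the null set u=0, v=0 or t=0 it is given by
  the formula, on that null set we set it to 0 (irrelevant for the integral).\<close>
definition Vker :: "real \<Rightarrow> real \<Rightarrow> 'n::finite heis \<Rightarrow> real" where
  "Vker \<alpha> \<beta> x = (case x of (u, v, t) \<Rightarrow>
     (let n = real CARD('n); \<rho> = \<bar>\<alpha> - n * \<beta>\<bar> / (n + 1) in
      if u = 0 \<or> v = 0 \<or> t = 0 then 0
      else norm u powr (\<alpha> - n) * norm v powr (\<alpha> - n) * \<bar>t\<bar> powr (\<beta> - 1) *
           (norm u * norm v / \<bar>t\<bar> + \<bar>t\<bar> / (norm u * norm v)) powr (- \<rho>)))"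

definition Iab :: "real \<Rightarrow> real \<Rightarrow> real \<Rightarrow> ('n::finite heis \<Rightarrow> real) \<Rightarrow> 'n heis \<Rightarrow> real" where
  "Iab \<mu> \<alpha> \<beta> f x = (\<integral>y. f y * Vker \<alpha> \<beta> (hmul \<mu> x (hinv y)) \<partial>lborel)"

definition inLp :: "real \<Rightarrow> ('a::euclidean_space \<Rightarrow> real) \<Rightarrow> bool" where
  "inLp p f \<longleftrightarrow> f \<in> borel_measurable lborel \<and> integrable lborel (\<lambda>x. \<bar>f x\<bar> powr p)"

definition Lpnorm :: "real \<Rightarrow> ('a::euclidean_space \<Rightarrow> real) \<Rightarrow> real" where
  "Lpnorm p f = (\<integral>x. \<bar>f x\<bar> powr p \<partial>lborel) powr (1 / p)"

end

theory Submission
  imports Defs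
begin

text \<open>
  Put \<open>\<gamma> = (\<alpha> + \<beta>) / (n + 1)\<close>. With \<open>r = |u||v| / |t|\<close> and \<open>\<sigma> = (\<alpha> - n\<beta>) / (n + 1)\<close> the kernel is
  \<open>|u|^(n(\<gamma>-1)) |v|^(n(\<gamma>-1)) |t|^(\<gamma>-1)\<close> times \<open>r^\<sigma> (r + 1/r)^(-|\<sigma>|) \<le> 1\<close>.

  If \<open>\<gamma> = 1/p - 1/q\<close>, each of the three factors is a Hardy-Littlewood-Sobolev kernel, and the group law
  enters only through a translation in \<open>t\<close>, which the one-dimensional inequality does not see. In bilinear
  form the inequalities tensorise by Tonelli, and testing against truncations of the output
  recovers the norm bound.

  The bilinear inequality itself comes from a pointwise estimate. For \<open>D = |x - y|^(-N)\<close> and densities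
  \<open>F\<close>, \<open>G\<close> of mass one, \<open>F^a G^b D^(2-a-b)\<close> is at most \<open>F G\<close> plus
  \<open>F D min(D/F, F/D)^e\<close> plus \<open>G D min(D/G, G/D)^e\<close>, and each of the last two integrates over
  the other variable to a multiple of \<open>F\<close> or \<open>G\<close>.

  Conversely, the kernel is homogeneous under the automorphisms \<open>(u, v, t) \<mapsto> (r u, r v, r^2 t)\<close>. Dilating the
  indicator of a ball forces the exponents to match, since its image under the operator is not zero.
\<close>

subsection \<open>Real powers of extended nonnegative reals\<close>

text \<open>\<open>top\<close> goes to \<open>top\<close> and 0 goes to 0 for every exponent, 0 and
  negative ones included. The convention makes \<open>epowr_mult\<close>, \<open>epowr_epowr\<close>
  and \<open>epowr_add\<close> hold without side conditions; only monotonicity asks for a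
  sign.\<close>

definition epowr :: "ennreal \<Rightarrow> real \<Rightarrow> ennreal" where
  "epowr x a = (if x = top then top else ennreal (enn2real x powr a))"

lemma epowr_ennreal: "0 \<le> x \<Longrightarrow> epowr (ennreal x) a = ennreal (x powr a)"
  by (simp add: epowr_def)

lemma epowr_top [simp]: "epowr top a = top"
  by (simp add: epowr_def)

lemma epowr_0 [simp]: "epowr 0 a = 0"
  by (simp add: epowr_def)

lemma epowr_eq_0_iff [simp]: "epowr x a = 0 \<longleftrightarrow> x = 0"
  by (cases x) (auto simp: epowr_ennreal ennreal_eq_0_iff)

lemma epowr_eq_top_iff [simp]: "epowr x a = top \<longleftrightarrow> x = top"
  by (simp add: epowr_def)

lemma measurable_epowr [measurable]: "(\<lambda>x. epowr x a) \<in> borel_measurable borel"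
  unfolding epowr_def by measurable

lemma measurable_epowr' [measurable (raw)]:
  "f \<in> borel_measurable M \<Longrightarrow> (\<lambda>x. epowr (f x) a) \<in> borel_measurable M"
  using measurable_compose[OF _ measurable_epowr] .

lemma epowr_mult: "epowr (x * y) a = epowr x a * epowr y a"
proof (cases "x = top \<or> y = top")
  case True
  then show ?thesis
    by (auto simp: ennreal_mult_eq_top_iff ennreal_mult_top ennreal_top_mult)
next
  case False
  then obtain r s where "x = ennreal r" "0 \<le> r" "y = ennreal s" "0 \<le> s"
    by (metis ennreal_cases infinity_ennreal_def)
  then show ?thesis
    by (simp add: epowr_ennreal powr_mult flip: ennreal_mult)
qed

lemma epowr_epowr: "epowr (epowr x a) b = epowr x (a * b)"
  by (cases x) (auto simp: epowr_ennreal powr_powr)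

lemma epowr_one [simp]: "epowr x 1 = x"
  by (cases x) (auto simp: epowr_ennreal)

lemma epowr_add: "epowr x (a + b) = epowr x a * epowr x b"
  by (cases x) (auto simp: epowr_ennreal powr_add ennreal_mult)

lemma epowr_mono: "x \<le> y \<Longrightarrow> 0 \<le> a \<Longrightarrow> epowr x a \<le> epowr y a"
  by (cases x; cases y) (auto simp: epowr_ennreal ennreal_leI powr_mono2 top_unique)

subsection \<open>Integrals of powers of the norm\<close>

text \<open>Summing over dyadic shells around the centre gives a geometric series.\<close>

lemma nn_integral_norm_powr_cball:
  fixes e :: real
  assumes "0 < e"
  shows "\<exists>K\<ge>0. \<forall>(c::'a::euclidean_space) R. 0 < R \<longrightarrow>
    (\<integral>\<^sup>+x. ennreal (norm (x - c) powr (e - DIM('a))) * indicator (cball c R) x \<partial>lborel) \<le> ennreal (K * R powr e)"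
proof -
  define N where "N = real DIM('a)"
  define V where "V = unit_ball_vol N"
  \<comment> \<open>The factor \<open>2 powr s\<close> pays for replacing a distance by a dyadic
    radius at most twice as large, whichever sign \<open>e - N\<close> has.\<close>
  define s where "s = \<bar>e - N\<bar>"
  define q where "q = 2 powr (- e)"
  have V: "V \<ge> 0" by (simp add: V_def N_def)
  have q: "0 < q" "q < 1" using assms by (auto simp: q_def powr_less_one)
  have bd: "(\<integral>\<^sup>+x. ennreal (norm (x - c) powr (e - N)) * indicator (cball c R) x \<partial>lborel)
       \<le> ennreal (2 powr s * V / (1 - q) * R powr e)" if R: "0 < R" for c :: 'a and R
  proof -
    \<comment> \<open>Each term lives on a full ball rather than on a shell. The overlap costs only
      a constant and the integral is a ball volume.\<close>
    define g where "g k x = ennreal (2 powr s * (R * 2 powr (- real k)) powr (e - N)) * indicator (cball c (R * 2 powr (- real k))) x"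
      for k and x :: 'a
    have gm: "g k \<in> borel_measurable lborel" for k
      unfolding g_def by (intro borel_measurable_times_ennreal borel_measurable_const borel_measurable_indicator) simp
    have "ennreal (norm (x - c) powr (e - N)) * indicator (cball c R) x \<le> (\<Sum>k. g k x)" for x
    proof (cases "x \<in> cball c R \<and> x \<noteq> c")
      case True
      define d where "d = norm (x - c)"
      have d: "0 < d" "d \<le> R" using True by (auto simp: d_def dist_norm norm_minus_commute)
      define k where "k = nat \<lfloor>log 2 (R / d)\<rfloor>"
      have l0: "0 \<le> log 2 (R / d)" using d R by (simp add: zero_le_log_cancel_iff)
      have k: "real k \<le> log 2 (R / d)" "log 2 (R / d) < real k + 1"
        using l0 unfolding k_def by linarith+
      have "2 powr (real k) \<le> R / d" using k d R by (simp add: le_log_iff)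
      then have k1: "d \<le> R * 2 powr (- real k)" using d by (simp add: powr_minus field_simps)
      have "R / d < 2 powr (real k + 1)" using k d R by (simp add: log_less_iff)
      then have k2: "R * 2 powr (- real k) \<le> 2 * d" using d by (simp add: powr_minus powr_add field_simps)
      define r where "r = R * 2 powr (- real k)"
      have r: "0 < r" "d \<le> r" "r \<le> 2 * d" using k1 k2 R by (auto simp: r_def)
      have "d powr (e - N) \<le> 2 powr s * r powr (e - N)"
      proof (cases "e \<ge> N")
        case True
        then have "d powr (e - N) \<le> 1 * r powr (e - N)" using r d by (simp add: powr_mono2)
        also have "\<dots> \<le> 2 powr s * r powr (e - N)"
          by (intro mult_right_mono) (auto simp: s_def ge_one_powr_ge_zero)
        finally show ?thesis .
      next
        case False
        then have "(2 * d) powr (e - N) \<le> r powr (e - N)" using r by (intro powr_mono2') auto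
        then have "2 powr s * ((2 * d) powr (e - N)) \<le> 2 powr s * r powr (e - N)" by simp
        moreover have "2 powr s * ((2 * d) powr (e - N)) = d powr (e - N)"
          using False d by (simp add: powr_mult s_def flip: powr_add mult.assoc)
        ultimately show ?thesis by simp
      qed
      then have "ennreal (norm (x - c) powr (e - N)) * indicator (cball c R) x \<le> g k x"
        using True r(2) by (auto simp: g_def d_def r_def dist_norm norm_minus_commute intro!: ennreal_leI)
      also have "\<dots> = sum (\<lambda>k. g k x) {k}" by simp
      also have "\<dots> \<le> (\<Sum>k. g k x)" by (intro sum_le_suminf) auto
      finally show ?thesis .
    \<comment> \<open>What remains is outside the ball, where the indicator is 0, and the centre
      itself, where \<open>0 powr\<close> is 0 by convention.\<close>
    qed auto
    then have "(\<integral>\<^sup>+x. ennreal (norm (x - c) powr (e - N)) * indicator (cball c R) x \<partial>lborel)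
       \<le> (\<integral>\<^sup>+x. (\<Sum>k. g k x) \<partial>lborel)" by (intro nn_integral_mono)
    also have "\<dots> = (\<Sum>k. \<integral>\<^sup>+x. g k x \<partial>lborel)"
      by (intro nn_integral_suminf gm)
    also have "\<dots> = (\<Sum>k. ennreal (2 powr s * V * R powr e * q ^ k))"
    proof (intro suminf_cong)
      fix k
      define r where "r = R * 2 powr (- real k)"
      have r: "0 < r" using R by (simp add: r_def)
      have "(\<integral>\<^sup>+x. g k x \<partial>lborel) = ennreal (2 powr s * r powr (e - N)) * ennreal (V * r ^ DIM('a))"
        using r unfolding g_def r_def[symmetric]
        by (subst nn_integral_cmult_indicator) (auto simp: emeasure_cball V_def N_def)
      also have "\<dots> = ennreal (2 powr s * V * (r powr (e - N) * r powr N))"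
        using r V by (simp add: N_def powr_realpow mult_ac flip: ennreal_mult)
      also have "r powr (e - N) * r powr N = r powr e" by (simp flip: powr_add)
      also have "r powr e = R powr e * q ^ k"
        using R by (simp add: r_def q_def powr_mult powr_powr powr_power mult.commute)
      finally show "(\<integral>\<^sup>+x. g k x \<partial>lborel) = ennreal (2 powr s * V * R powr e * q ^ k)"
        by (simp add: mult_ac)
    qed
    also have "\<dots> = ennreal (\<Sum>k. 2 powr s * V * R powr e * q ^ k)"
      using V q by (intro suminf_ennreal2 summable_mult summable_geometric) auto
    also have "(\<Sum>k. 2 powr s * V * R powr e * q ^ k) = 2 powr s * V * R powr e * (1 / (1 - q))"
      using q by (subst suminf_mult) (auto simp: suminf_geometric intro!: summable_geometric)
    finally show ?thesis by (simp add: mult_ac)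
  qed
  show ?thesis
    by (rule exI[of _ "2 powr s * V / (1 - q)"]) (use bd V q in \<open>auto simp: N_def\<close>)
qed

text \<open>The dyadic sum now runs outward over the radii \<open>R * 2 powr k\<close>. The exponent
  is negative, so the power is at most its value at the inner radius of a shell; the ball of twice
  that radius contains the shell, whence \<open>2 powr N\<close>.\<close>

lemma nn_integral_norm_powr_outside_cball:
  fixes e :: real
  assumes "0 < e"
  shows "\<exists>K\<ge>0. \<forall>(c::'a::euclidean_space) R. 0 < R \<longrightarrow>
    (\<integral>\<^sup>+x. ennreal (norm (x - c) powr (- e - DIM('a))) * indicator (- ball c R) x \<partial>lborel) \<le> ennreal (K * R powr (- e))"
proof -
  define N where "N = real DIM('a)"
  define V where "V = unit_ball_vol N"
  define q where "q = 2 powr (- e)"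
  have V: "V \<ge> 0" by (simp add: V_def N_def)
  have q: "0 < q" "q < 1" using assms by (auto simp: q_def powr_less_one)
  have bd: "(\<integral>\<^sup>+x. ennreal (norm (x - c) powr (- e - N)) * indicator (- ball c R) x \<partial>lborel)
       \<le> ennreal (2 powr N * V / (1 - q) * R powr (- e))" if R: "0 < R" for c :: 'a and R
  proof -
    define g where "g k x = ennreal ((R * 2 powr real k) powr (- e - N)) * indicator (cball c (2 * (R * 2 powr real k))) x"
      for k and x :: 'a
    have gm: "g k \<in> borel_measurable lborel" for k
      unfolding g_def by (intro borel_measurable_times_ennreal borel_measurable_const borel_measurable_indicator) simp
    have "ennreal (norm (x - c) powr (- e - N)) * indicator (- ball c R) x \<le> (\<Sum>k. g k x)" for x
    proof (cases "x \<in> ball c R")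
      case False
      define d where "d = norm (x - c)"
      have d: "0 < d" "R \<le> d" using False R unfolding d_def by (auto simp: dist_norm norm_minus_commute)
      define k where "k = nat \<lfloor>log 2 (d / R)\<rfloor>"
      have l0: "0 \<le> log 2 (d / R)" using d R by (simp add: zero_le_log_cancel_iff)
      have k: "real k \<le> log 2 (d / R)" "log 2 (d / R) < real k + 1"
        using l0 unfolding k_def by linarith+
      have "2 powr (real k) \<le> d / R" using k d R by (simp add: le_log_iff)
      then have k1: "R * 2 powr real k \<le> d" using R by (simp add: field_simps)
      have "d / R < 2 powr (real k + 1)" using k d R by (simp add: log_less_iff)
      then have k2: "d \<le> 2 * (R * 2 powr real k)" using R by (simp add: powr_add field_simps)
      have "d powr (- e - N) \<le> (R * 2 powr real k) powr (- e - N)"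
        using k1 R assms by (intro powr_mono2') (auto simp: N_def)
      then have "ennreal (norm (x - c) powr (- e - N)) * indicator (- ball c R) x \<le> g k x"
        using False k2 by (auto simp: g_def d_def dist_norm norm_minus_commute intro!: ennreal_leI)
      also have "\<dots> = sum (\<lambda>k. g k x) {k}" by simp
      also have "\<dots> \<le> (\<Sum>k. g k x)" by (intro sum_le_suminf) auto
      finally show ?thesis .
    qed auto
    then have "(\<integral>\<^sup>+x. ennreal (norm (x - c) powr (- e - N)) * indicator (- ball c R) x \<partial>lborel)
       \<le> (\<integral>\<^sup>+x. (\<Sum>k. g k x) \<partial>lborel)" by (intro nn_integral_mono)
    also have "\<dots> = (\<Sum>k. \<integral>\<^sup>+x. g k x \<partial>lborel)"
      by (intro nn_integral_suminf gm)
    also have "\<dots> = (\<Sum>k. ennreal (2 powr N * V * R powr (- e) * q ^ k))"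
    proof (intro suminf_cong)
      fix k
      define r where "r = R * 2 powr real k"
      have r: "0 < r" using R by (simp add: r_def)
      have "(\<integral>\<^sup>+x. g k x \<partial>lborel) = ennreal (r powr (- e - N)) * ennreal (V * (2 * r) ^ DIM('a))"
        using r unfolding g_def r_def[symmetric]
        by (subst nn_integral_cmult_indicator) (auto simp: emeasure_cball V_def N_def)
      also have "\<dots> = ennreal (2 powr N * V * (r powr (- e - N) * r powr N))"
        using r V by (simp add: N_def powr_realpow mult_ac power_mult_distrib flip: ennreal_mult)
      also have "r powr (- e - N) * r powr N = r powr (- e)" by (simp flip: powr_add)
      also have "r powr (- e) = R powr (- e) * q ^ k"
        using R by (simp add: r_def q_def powr_mult powr_powr powr_power mult.commute)
      finally show "(\<integral>\<^sup>+x. g k x \<partial>lborel) = ennreal (2 powr N * V * R powr (- e) * q ^ k)"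
        by (simp add: mult_ac)
    qed
    also have "\<dots> = ennreal (\<Sum>k. 2 powr N * V * R powr (- e) * q ^ k)"
      using V q by (intro suminf_ennreal2 summable_mult summable_geometric) auto
    also have "(\<Sum>k. 2 powr N * V * R powr (- e) * q ^ k) = 2 powr N * V * R powr (- e) * (1 / (1 - q))"
      using q by (subst suminf_mult) (auto simp: suminf_geometric intro!: summable_geometric)
    finally show ?thesis by (simp add: mult_ac)
  qed
  show ?thesis
    by (rule exI[of _ "2 powr N * V / (1 - q)"]) (use bd V q in \<open>auto simp: N_def\<close>)
qed

subsection \<open>The pointwise estimate\<close>

text \<open>For \<open>F\<close>, \<open>D > 0\<close> this is \<open>F D min(D/F, F/D)^e\<close>.\<close>

definition hls_weight :: "real \<Rightarrow> real \<Rightarrow> real \<Rightarrow> real" where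
  "hls_weight e D F = (if D \<le> F then F powr (1 - e) * D powr (1 + e) else F powr (1 + e) * D powr (1 - e))"

lemma hls_weight_nonneg [simp]: "0 \<le> hls_weight e D F"
  by (simp add: hls_weight_def)

text \<open>Both sides are a power of \<open>F / D\<close> times \<open>D powr 2\<close>, so the
  exponent may grow when \<open>F / D\<close> is at least 1 and shrink when it is at most 1.\<close>

lemma powr_mult_powr_shift:
  fixes F D :: real
  assumes "0 < F" "0 < D" and "D \<le> F \<and> s \<le> t \<or> F \<le> D \<and> t \<le> s"
  shows "F powr s * D powr (2 - s) \<le> F powr t * D powr (2 - t)"
proof -
  have eq: "F powr r * D powr (2 - r) = (F / D) powr r * D powr 2" for r
    using assms by (simp add: powr_divide powr_diff)
  have "(F / D) powr s \<le> (F / D) powr t"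
    using assms by (auto intro: powr_mono powr_mono')
  then show ?thesis unfolding eq by (intro mult_right_mono) auto
qed

text \<open>The exponents on the left add up to 2, and the cases follow the order of
  \<open>F\<close>, \<open>G\<close>, \<open>D\<close>. If \<open>D\<close> is the smallest, the
  powers left over after splitting off \<open>F * G\<close> have negative exponents and
  \<open>D\<close> bounds them. Otherwise one factor is absorbed into a larger one and the exponent
  is shifted. The three bounds on \<open>e\<close> are what these shifts require.\<close>

lemma hls_pointwise:
  fixes F G D a b e :: real
  assumes "0 \<le> F" "0 \<le> G" "0 < D" "0 < a" "0 < b"
    and e: "e \<le> 1 - a" "e \<le> 1 - b" "e \<le> a + b - 1"
    and ab: "a < 1" "b < 1"
  shows "F powr a * G powr b * D powr (2 - a - b) \<le> F * G + hls_weight e D F + hls_weight e D G"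
proof (cases "F = 0 \<or> G = 0")
  case True
  then show ?thesis using assms by (auto intro!: add_nonneg_nonneg)
next
  case False
  then have pos: "0 < F" "0 < G" using assms by auto
  \<comment> \<open>Here \<open>D\<close> lies between the two densities: \<open>Y\<close> is raised
    to \<open>D\<close>, and the exponent of \<open>X\<close> then grows from \<open>x\<close> to
    \<open>1 - e\<close>.\<close>
  have mixed: "X powr x * Y powr y * D powr (2 - x - y) \<le> hls_weight e D X"
    if "0 < X" "0 < Y" "D \<le> X" "Y \<le> D" "e \<le> 1 - x" "0 < y" for X Y x y
  proof -
    have "X powr x * Y powr y * D powr (2 - x - y) \<le> X powr x * D powr y * D powr (2 - x - y)"
      using that by (intro mult_right_mono mult_left_mono powr_mono2) auto
    also have "\<dots> = X powr x * D powr (2 - x)" by (simp add: mult.assoc flip: powr_add)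
    also have "\<dots> \<le> X powr (1 - e) * D powr (2 - (1 - e))"
      using that \<open>0 < D\<close> by (intro powr_mult_powr_shift) auto
    finally show ?thesis using that by (simp add: hls_weight_def)
  qed
  \<comment> \<open>Here both densities are at most \<open>D\<close>: \<open>X\<close> is raised to
    \<open>Y\<close>, and the exponent \<open>x + y\<close> then drops to
    \<open>1 + e\<close>.\<close>
  have small: "X powr x * Y powr y * D powr (2 - x - y) \<le> hls_weight e D Y"
    if "0 < X" "0 < Y" "Y < D" "X \<le> Y" "e \<le> x + y - 1" "0 < x" for X Y x y
  proof -
    have "X powr x * Y powr y * D powr (2 - x - y) \<le> Y powr x * Y powr y * D powr (2 - x - y)"
      using that by (intro mult_right_mono powr_mono2) auto
    also have "\<dots> = Y powr (x + y) * D powr (2 - (x + y))"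
      by (simp add: powr_add diff_diff_eq)
    also have "\<dots> \<le> Y powr (1 + e) * D powr (2 - (1 + e))"
      using that \<open>0 < D\<close> by (intro powr_mult_powr_shift) auto
    finally show ?thesis using that by (simp add: hls_weight_def)
  qed
  have nn: "0 \<le> F * G" "0 \<le> hls_weight e D F" "0 \<le> hls_weight e D G" using pos by auto
  have swap: "F powr a * G powr b * D powr (2 - a - b) = G powr b * F powr a * D powr (2 - b - a)"
  proof -
    have "2 - a - b = 2 - b - a" by simp
    then show ?thesis by (simp only: mult.commute[of "F powr a"])
  qed
  consider "D \<le> F" "D \<le> G" | "D \<le> F" "G < D" | "F < D" "D \<le> G" | "F < D" "G < D" "F \<le> G" | "F < D" "G < D" "G \<le> F"
    by linarith
  then show ?thesis
  proof cases
    case 1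
    have "F powr a * G powr b * D powr (2 - a - b)
        = F * G * (F powr (a - 1) * G powr (b - 1)) * D powr (2 - a - b)"
      using pos by (simp add: powr_diff)
    also have "\<dots> \<le> F * G * (D powr (a - 1) * D powr (b - 1)) * D powr (2 - a - b)"
      using 1 pos ab \<open>0 < D\<close> by (intro mult_right_mono mult_left_mono mult_mono powr_mono2') auto
    also have "\<dots> = F * G * D powr ((a - 1) + (b - 1) + (2 - a - b))"
      by (simp only: powr_add mult.assoc)
    also have "\<dots> = F * G" using \<open>0 < D\<close> by simp
    finally show ?thesis using nn by linarith
  next
    case 2
    then have "F powr a * G powr b * D powr (2 - a - b) \<le> hls_weight e D F"
      using pos assms by (intro mixed) auto
    then show ?thesis using nn by linarith
  next
    case 3
    then have "F powr a * G powr b * D powr (2 - a - b) \<le> hls_weight e D G"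
      unfolding swap using pos assms by (intro mixed) auto
    then show ?thesis using nn by linarith
  next
    case 4
    then have "F powr a * G powr b * D powr (2 - a - b) \<le> hls_weight e D G"
      using pos assms by (intro small) auto
    then show ?thesis using nn by linarith
  next
    case 5
    then have "F powr a * G powr b * D powr (2 - a - b) \<le> hls_weight e D F"
      unfolding swap using pos assms by (intro small) auto
    then show ?thesis using nn by linarith
  qed
qed

text \<open>The two branches meet where the distance to \<open>c\<close> is
  \<open>R = F powr (- 1 / N)\<close>. Inside, the weight has order \<open>N * e - N\<close> in the
  distance and is integrable at \<open>c\<close>; outside it has order \<open>- (N * e) - N\<close>
  and is integrable at infinity. The powers of \<open>R\<close> turn both contributions into
  multiples of \<open>F\<close>.\<close>

lemma nn_integral_hls_weight:
  fixes e :: real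
  assumes "0 < e"
  shows "\<exists>K\<ge>0. \<forall>(c::'a::euclidean_space) F. 0 \<le> F \<longrightarrow>
    (\<integral>\<^sup>+x. ennreal (hls_weight e (norm (x - c) powr (- real DIM('a))) F) \<partial>lborel) \<le> ennreal (K * F)"
proof -
  define N where "N = real DIM('a)"
  have N: "0 < N" by (simp add: N_def)
  have Ne: "0 < N * e" using N assms by simp
  obtain K1 where K1: "K1 \<ge> 0" "\<And>(c::'a) R. 0 < R \<Longrightarrow> 
    (\<integral>\<^sup>+x. ennreal (norm (x - c) powr (N * e - N)) * indicator (cball c R) x \<partial>lborel) \<le> ennreal (K1 * R powr (N * e))"
    using nn_integral_norm_powr_cball[OF Ne, where 'a='a] unfolding N_def by blast
  obtain K2 where K2: "K2 \<ge> 0" "\<And>(c::'a) R. 0 < R \<Longrightarrow> 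
    (\<integral>\<^sup>+x. ennreal (norm (x - c) powr (- (N * e) - N)) * indicator (- ball c R) x \<partial>lborel) \<le> ennreal (K2 * R powr (- (N * e)))"
    using nn_integral_norm_powr_outside_cball[OF Ne, where 'a='a] unfolding N_def by blast
  have "(\<integral>\<^sup>+x. ennreal (hls_weight e (norm (x - c) powr (- N)) F) \<partial>lborel) \<le> ennreal ((K1 + K2) * F)"
    if "0 \<le> F" for c :: 'a and F
  proof (cases "F = 0")
    case True
    then have "hls_weight e (norm (x - c) powr (- N)) F = 0" for x
      by (auto simp: hls_weight_def)
    then show ?thesis using True by simp
  next
    case False
    with that have F: "0 < F" by simp
    define R where "R = F powr (- 1 / N)"
    have R: "0 < R" using F by (simp add: R_def)
    have pw: "ennreal (hls_weight e (norm (x - c) powr (- N)) F) \<le>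
        ennreal (F powr (1 + e)) * (ennreal (norm (x - c) powr (N * e - N)) * indicator (cball c R) x) +
        ennreal (F powr (1 - e)) * (ennreal (norm (x - c) powr (- (N * e) - N)) * indicator (- ball c R) x)" for x
    proof (cases "x = c")
      \<comment> \<open>At the centre \<open>0 powr (- N)\<close> is 0 rather than infinite, so the
        weight vanishes there.\<close>
      case True
      then show ?thesis using that by (simp add: hls_weight_def)
    next
      case False
      define d where "d = norm (x - c)"
      have d: "0 < d" using False by (simp add: d_def)
      have RN: "R powr (- N) = F" using F N by (simp add: R_def powr_powr)
      have iff: "d powr (- N) \<le> F \<longleftrightarrow> R \<le> d"
        unfolding RN[symmetric] using R d N by (metis le_less_linear less_eq_real_def neg_0_less_iff_less neg_less_0_iff_less not_less powr_less_mono2_neg powr_mono2')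
      show ?thesis
      proof (cases "R \<le> d")
        case True
        then have "x \<in> - ball c R" by (simp add: d_def dist_norm norm_minus_commute)
        moreover have "hls_weight e (d powr (- N)) F = F powr (1 - e) * d powr (- (N * e) - N)"
        proof -
          have "- N * (1 + e) = - (N * e) - N" by (simp add: algebra_simps)
          then show ?thesis using True by (simp add: hls_weight_def iff powr_powr)
        qed
        ultimately show ?thesis unfolding d_def[symmetric] by (simp add: ennreal_mult)
      next
        case False
        then have "x \<in> cball c R" by (simp add: d_def dist_norm norm_minus_commute)
        moreover have "hls_weight e (d powr (- N)) F = F powr (1 + e) * d powr (N * e - N)"
          using False by (simp add: hls_weight_def iff powr_powr algebra_simps)
        ultimately show ?thesis unfolding d_def[symmetric] by (simp add: ennreal_mult)
      qed
    qed
    have m1: "(\<lambda>x. ennreal (norm (x - c) powr (N * e - N)) * indicator (cball c R) x) \<in> borel_measurable lborel"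
      by (intro borel_measurable_times_ennreal borel_measurable_indicator) auto
    have m2: "(\<lambda>x. ennreal (norm (x - c) powr (- (N * e) - N)) * indicator (- ball c R) x) \<in> borel_measurable lborel"
      by (intro borel_measurable_times_ennreal borel_measurable_indicator) auto
    have "(\<integral>\<^sup>+x. ennreal (hls_weight e (norm (x - c) powr (- N)) F) \<partial>lborel) \<le>
        (\<integral>\<^sup>+x. ennreal (F powr (1 + e)) * (ennreal (norm (x - c) powr (N * e - N)) * indicator (cball c R) x) +
        ennreal (F powr (1 - e)) * (ennreal (norm (x - c) powr (- (N * e) - N)) * indicator (- ball c R) x) \<partial>lborel)"
      by (intro nn_integral_mono pw)
    also have "\<dots> = ennreal (F powr (1 + e)) * (\<integral>\<^sup>+x. ennreal (norm (x - c) powr (N * e - N)) * indicator (cball c R) x \<partial>lborel)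
        + ennreal (F powr (1 - e)) * (\<integral>\<^sup>+x. ennreal (norm (x - c) powr (- (N * e) - N)) * indicator (- ball c R) x \<partial>lborel)"
      using m1 m2 by (simp add: nn_integral_add nn_integral_cmult)
    also have "\<dots> \<le> ennreal (F powr (1 + e)) * ennreal (K1 * R powr (N * e)) + ennreal (F powr (1 - e)) * ennreal (K2 * R powr (- (N * e)))"
      using K1(2)[OF R] K2(2)[OF R] by (intro add_mono mult_left_mono) auto
    also have "\<dots> = ennreal (F powr (1 + e) * (K1 * R powr (N * e)) + F powr (1 - e) * (K2 * R powr (- (N * e))))"
      using K1(1) K2(1) by (simp add: ennreal_mult)
    also have "F powr (1 + e) * (K1 * R powr (N * e)) + F powr (1 - e) * (K2 * R powr (- (N * e))) = (K1 + K2) * F"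
    proof -
      have "R powr (N * e) = F powr (- e)" "R powr (- (N * e)) = F powr e"
        using N by (simp_all add: R_def powr_powr)
      moreover have "F powr (1 + e) * F powr (- e) = F" "F powr (1 - e) * F powr e = F"
        using F by (simp_all flip: powr_add)
      ultimately show ?thesis by (simp add: algebra_simps)
    qed
    finally show ?thesis .
  qed
  then show ?thesis using K1(1) K2(1) by (intro exI[of _ "K1 + K2"]) (auto simp: N_def)
qed

lemma measurable_hls_weight [measurable (raw)]:
  assumes [measurable]: "f \<in> borel_measurable M" "g \<in> borel_measurable M"
  shows "(\<lambda>x. hls_weight e (f x) (g x)) \<in> borel_measurable M"
  unfolding hls_weight_def by measurable

subsection \<open>The Hardy-Littlewood-Sobolev inequality\<close>

text \<open>With f = F^a and g = G^b the right-hand side is C times the L^(1/a) norm of f and the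
  L^(1/b) norm of g. Writing it with the densities \<open>F\<close> and \<open>G\<close> leaves
  plain integrals inside the powers, and these can be iterated by Tonelli.\<close>

definition hls_bounded :: "real \<Rightarrow> real \<Rightarrow> ennreal \<Rightarrow> ('a::euclidean_space \<Rightarrow> 'a \<Rightarrow> ennreal) \<Rightarrow> bool" where
  "hls_bounded a b C k \<longleftrightarrow> (\<forall>F G. F \<in> borel_measurable borel \<longrightarrow> G \<in> borel_measurable borel \<longrightarrow>
     (\<integral>\<^sup>+x. \<integral>\<^sup>+y. epowr (F y) a * epowr (G x) b * k x y \<partial>lborel \<partial>lborel)
       \<le> C * (epowr (\<integral>\<^sup>+y. F y \<partial>lborel) a * epowr (\<integral>\<^sup>+x. G x \<partial>lborel) b))"

text \<open>Integrating the pointwise estimate gives the constant \<open>1 + K + K\<close>. Since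
  \<open>K\<close> does not depend on the centre, the bound is uniform in the shift
  \<open>s\<close>, which later absorbs the twist of the group law.\<close>

lemma hls_normalised:
  fixes a b :: real
  assumes ab: "a < 1" "b < 1" "1 < a + b"
  shows "\<exists>C>0. \<forall>(s::'a::euclidean_space) (F::'a \<Rightarrow> real) G.
    F \<in> borel_measurable borel \<longrightarrow> G \<in> borel_measurable borel \<longrightarrow> (\<forall>y. 0 \<le> F y) \<longrightarrow> (\<forall>x. 0 \<le> G x) \<longrightarrow>
    (\<integral>\<^sup>+y. F y \<partial>lborel) = 1 \<longrightarrow> (\<integral>\<^sup>+x. G x \<partial>lborel) = 1 \<longrightarrow>
    (\<integral>\<^sup>+x. \<integral>\<^sup>+y. ennreal (F y powr a * G x powr b * norm (x - y - s) powr (- real DIM('a) * (2 - a - b))) \<partial>lborel \<partial>lborel)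
       \<le> ennreal C"
proof -
  define N where "N = real DIM('a)"
  \<comment> \<open>The largest exponent that \<open>hls_pointwise\<close> admits; it is positive
    because the three hypotheses are strict.\<close>
  define e where "e = min (1 - a) (min (1 - b) (a + b - 1))"
  have e: "0 < e" "e \<le> 1 - a" "e \<le> 1 - b" "e \<le> a + b - 1" using ab by (auto simp: e_def)
  obtain K where K: "K \<ge> 0" and KF: "\<And>(c::'a) F. 0 \<le> F \<Longrightarrow>
    (\<integral>\<^sup>+x. ennreal (hls_weight e (norm (x - c) powr (- N)) F) \<partial>lborel) \<le> ennreal (K * F)"
    using nn_integral_hls_weight[OF e(1), where 'a='a] unfolding N_def by blast
  have "(\<integral>\<^sup>+x. \<integral>\<^sup>+y. ennreal (F y powr a * G x powr b * norm (x - y - s) powr (- N * (2 - a - b))) \<partial>lborel \<partial>lborel)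
       \<le> ennreal (1 + K + K)"
    if [measurable]: "F \<in> borel_measurable borel" "G \<in> borel_measurable borel"
      and nn: "\<And>y. 0 \<le> F y" "\<And>x. 0 \<le> G x"
      and F1: "(\<integral>\<^sup>+y. F y \<partial>lborel) = 1" and G1: "(\<integral>\<^sup>+x. G x \<partial>lborel) = 1"
    for s :: 'a and F G :: "'a \<Rightarrow> real"
  proof -
    define D where "D x y = norm (x - y - s) powr (- N)" for x y
    have Dm [measurable]: "(\<lambda>(x, y). D x y) \<in> borel_measurable (borel \<Otimes>\<^sub>M borel)"
      unfolding D_def by measurable
    have Dm1 [measurable]: "D x \<in> borel_measurable borel" for x
      unfolding D_def by measurable
    have pw: "ennreal (F y powr a * G x powr b * norm (x - y - s) powr (- N * (2 - a - b)))
        \<le> ennreal (F y) * ennreal (G x) + ennreal (hls_weight e (D x y) (F y)) + ennreal (hls_weight e (D x y) (G x))"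
      for x y
    proof (cases "x - y - s = 0")
      case False
      then have "F y powr a * G x powr b * D x y powr (2 - a - b)
        \<le> F y * G x + hls_weight e (D x y) (F y) + hls_weight e (D x y) (G x)"
        using nn e ab by (intro hls_pointwise) (auto simp: D_def)
      then show ?thesis using nn by (simp add: D_def powr_powr flip: ennreal_mult ennreal_plus)
    qed simp
    have "(\<integral>\<^sup>+x. \<integral>\<^sup>+y. ennreal (F y powr a * G x powr b * norm (x - y - s) powr (- N * (2 - a - b))) \<partial>lborel \<partial>lborel)
      \<le> (\<integral>\<^sup>+x. \<integral>\<^sup>+y. ennreal (F y) * ennreal (G x) + ennreal (hls_weight e (D x y) (F y)) + ennreal (hls_weight e (D x y) (G x)) \<partial>lborel \<partial>lborel)"
      by (intro nn_integral_mono pw)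
    also have "\<dots> = (\<integral>\<^sup>+x. \<integral>\<^sup>+y. ennreal (F y) * ennreal (G x) \<partial>lborel \<partial>lborel)
        + (\<integral>\<^sup>+x. \<integral>\<^sup>+y. ennreal (hls_weight e (D x y) (F y)) \<partial>lborel \<partial>lborel)
        + (\<integral>\<^sup>+x. \<integral>\<^sup>+y. ennreal (hls_weight e (D x y) (G x)) \<partial>lborel \<partial>lborel)"
      by (simp add: nn_integral_add)
    also have "(\<integral>\<^sup>+x. \<integral>\<^sup>+y. ennreal (F y) * ennreal (G x) \<partial>lborel \<partial>lborel) = 1"
      by (simp add: nn_integral_multc F1 G1)
    \<comment> \<open>The weight of \<open>F y\<close> has to be integrated over \<open>x\<close>
      first, hence the exchange. The weight of \<open>G x\<close> already has \<open>y\<close> as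
      its inner variable.\<close>
    also have "(\<integral>\<^sup>+x. \<integral>\<^sup>+y. ennreal (hls_weight e (D x y) (F y)) \<partial>lborel \<partial>lborel)
       = (\<integral>\<^sup>+y. \<integral>\<^sup>+x. ennreal (hls_weight e (D x y) (F y)) \<partial>lborel \<partial>lborel)"
      by (rule lborel_pair.Fubini') measurable
    also have "\<dots> \<le> (\<integral>\<^sup>+y. ennreal K * ennreal (F y) \<partial>lborel)"
    proof (intro nn_integral_mono)
      fix y
      show "(\<integral>\<^sup>+x. ennreal (hls_weight e (D x y) (F y)) \<partial>lborel) \<le> ennreal K * ennreal (F y)"
        using KF[of "F y" "y + s"] nn K by (simp add: D_def diff_diff_eq ennreal_mult)
    qed
    also have "\<dots> = ennreal K" by (simp add: nn_integral_cmult F1)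
    also have "(\<integral>\<^sup>+x. \<integral>\<^sup>+y. ennreal (hls_weight e (D x y) (G x)) \<partial>lborel \<partial>lborel)
       \<le> (\<integral>\<^sup>+x. ennreal K * ennreal (G x) \<partial>lborel)"
    proof (intro nn_integral_mono)
      fix x
      have "norm (x - y - s) = norm (y - (x - s))" for y
        using norm_minus_commute[of "x - s" y] by (simp add: algebra_simps)
      then show "(\<integral>\<^sup>+y. ennreal (hls_weight e (D x y) (G x)) \<partial>lborel) \<le> ennreal K * ennreal (G x)"
        using KF[of "G x" "x - s"] nn K by (simp add: D_def ennreal_mult)
    qed
    also have "\<dots> = ennreal K" by (simp add: nn_integral_cmult G1)
    also have "1 + ennreal K + ennreal K = ennreal (1 + K + K)"
      by (simp only: ennreal_plus add_nonneg_nonneg zero_le_one ennreal_1 K)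
    finally show ?thesis by (simp add: add_mono)
  qed
  then show ?thesis using K by (intro exI[of _ "1 + K + K"]) (auto simp: N_def)
qed

text \<open>A finite integral makes \<open>F\<close> finite almost everywhere, so passing to real
  values and dividing by the mass changes \<open>F\<close> only on a null set.\<close>

lemma AE_eq_scaled_enn2real:
  fixes F :: "'a::euclidean_space \<Rightarrow> ennreal"
  assumes [measurable]: "F \<in> borel_measurable borel"
    and A: "(\<integral>\<^sup>+y. F y \<partial>lborel) = ennreal A" "0 < A"
  defines "F' \<equiv> \<lambda>y. enn2real (F y) / A"
  shows "AE y in lborel. F y = ennreal A * ennreal (F' y)" and "(\<integral>\<^sup>+y. F' y \<partial>lborel) = 1"
proof -
  have "AE y in lborel. F y \<noteq> \<infinity>"
    using A by (intro nn_integral_PInf_AE) auto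
  then show ae: "AE y in lborel. F y = ennreal A * ennreal (F' y)"
  proof eventually_elim
    case (elim y)
    then show ?case using A by (simp add: F'_def ennreal_enn2real less_top flip: ennreal_mult)
  qed
  have "ennreal A = (\<integral>\<^sup>+y. ennreal A * ennreal (F' y) \<partial>lborel)"
    unfolding A(1)[symmetric] using ae by (intro nn_integral_cong_AE) (auto simp: A(1))
  also have "\<dots> = ennreal A * (\<integral>\<^sup>+y. F' y \<partial>lborel)"
    by (intro nn_integral_cmult) (simp add: F'_def)
  finally have "ennreal A * 1 = ennreal A * (\<integral>\<^sup>+y. F' y \<partial>lborel)" by simp
  then show "(\<integral>\<^sup>+y. F' y \<partial>lborel) = 1"
    unfolding ennreal_mult_cancel_left using A(2) by auto
qed

text \<open>Both sides are homogeneous of degree \<open>a\<close> in \<open>F\<close> and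
  \<open>b\<close> in \<open>G\<close>, which reduces positive finite masses to mass one.\<close>

lemma hls_bounded_norm_powr:
  fixes a b :: real
  assumes ab: "a < 1" "b < 1" "1 < a + b"
  shows "\<exists>C>0. \<forall>s::'a::euclidean_space.
    hls_bounded a b (ennreal C) (\<lambda>x y. ennreal (norm (x - y - s) powr (- real DIM('a) * (2 - a - b))))"
proof -
  define L where "L = - real DIM('a) * (2 - a - b)"
  obtain C where C: "C > 0" and CB: "\<And>(s::'a) (F::'a \<Rightarrow> real) G.
    \<lbrakk>F \<in> borel_measurable borel; G \<in> borel_measurable borel; \<And>y. 0 \<le> F y; \<And>x. 0 \<le> G x;
    (\<integral>\<^sup>+y. F y \<partial>lborel) = 1; (\<integral>\<^sup>+x. G x \<partial>lborel) = 1\<rbrakk> \<Longrightarrow>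
    (\<integral>\<^sup>+x. \<integral>\<^sup>+y. ennreal (F y powr a * G x powr b * norm (x - y - s) powr L) \<partial>lborel \<partial>lborel)
       \<le> ennreal C"
    using hls_normalised[OF ab, where 'a='a] unfolding L_def by blast
  have "(\<integral>\<^sup>+x. \<integral>\<^sup>+y. epowr (F y) a * epowr (G x) b * ennreal (norm (x - y - s) powr L) \<partial>lborel \<partial>lborel)
       \<le> ennreal C * (epowr (\<integral>\<^sup>+y. F y \<partial>lborel) a * epowr (\<integral>\<^sup>+x. G x \<partial>lborel) b)"
    if m [measurable]: "F \<in> borel_measurable borel" "G \<in> borel_measurable borel" for F G :: "'a \<Rightarrow> ennreal" and s
  proof -
    \<comment> \<open>Zero masses come before infinite ones: as \<open>0 * top = 0\<close>, the
      right-hand side is 0 even if the other mass is infinite, and the left-hand side must be shown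
      to vanish.\<close>
    consider "(\<integral>\<^sup>+y. F y \<partial>lborel) = 0" | "(\<integral>\<^sup>+x. G x \<partial>lborel) = 0"
      | "(\<integral>\<^sup>+y. F y \<partial>lborel) \<noteq> 0" "(\<integral>\<^sup>+x. G x \<partial>lborel) \<noteq> 0"
        "(\<integral>\<^sup>+y. F y \<partial>lborel) = top \<or> (\<integral>\<^sup>+x. G x \<partial>lborel) = top"
      | A B where "(\<integral>\<^sup>+y. F y \<partial>lborel) = ennreal A" "(\<integral>\<^sup>+x. G x \<partial>lborel) = ennreal B" "0 < A" "0 < B"
    proof (cases "(\<integral>\<^sup>+y. F y \<partial>lborel)"; cases "(\<integral>\<^sup>+x. G x \<partial>lborel)")
    qed (use that in \<open>force simp: ennreal_eq_0_iff\<close>)+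
    then show ?thesis
    proof cases
      case 1
      then have "AE y in lborel. F y = 0" by (simp add: nn_integral_0_iff_AE)
      then have "(\<integral>\<^sup>+y. epowr (F y) a * epowr (G x) b * ennreal (norm (x - y - s) powr L) \<partial>lborel) = 0" for x
        by (subst nn_integral_0_iff_AE) auto
      then show ?thesis by simp
    next
      case 2
      then have "AE x in lborel. G x = 0" by (simp add: nn_integral_0_iff_AE)
      then have "(\<integral>\<^sup>+x. \<integral>\<^sup>+y. epowr (F y) a * epowr (G x) b * ennreal (norm (x - y - s) powr L) \<partial>lborel \<partial>lborel) = 0"
        by (subst nn_integral_0_iff_AE) auto
      then show ?thesis by simp
    next
      case 3
      then have "ennreal C * (epowr (\<integral>\<^sup>+y. F y \<partial>lborel) a * epowr (\<integral>\<^sup>+x. G x \<partial>lborel) b) = top"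
        using C by (auto simp: ennreal_mult_eq_top_iff)
      then show ?thesis by simp
    next
      case (4 A B)
      define F' where "F' y = enn2real (F y) / A" for y
      define G' where "G' x = enn2real (G x) / B" for x
      have [measurable]: "F' \<in> borel_measurable borel" "G' \<in> borel_measurable borel"
        unfolding F'_def G'_def by measurable
      have nn: "0 \<le> F' y" "0 \<le> G' y" for y using 4 by (auto simp: F'_def G'_def)
      have F: "AE y in lborel. F y = ennreal A * ennreal (F' y)" "(\<integral>\<^sup>+y. F' y \<partial>lborel) = 1"
        using AE_eq_scaled_enn2real[OF m(1) 4(1,3)] unfolding F'_def by auto
      have G: "AE y in lborel. G y = ennreal B * ennreal (G' y)" "(\<integral>\<^sup>+y. G' y \<partial>lborel) = 1"
        using AE_eq_scaled_enn2real[OF m(2) 4(2,4)] unfolding G'_def by auto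
      define Q where "Q = ennreal (A powr a * B powr b)"
      have "(\<integral>\<^sup>+x. \<integral>\<^sup>+y. epowr (F y) a * epowr (G x) b * ennreal (norm (x - y - s) powr L) \<partial>lborel \<partial>lborel)
         = (\<integral>\<^sup>+x. \<integral>\<^sup>+y. Q * ennreal (F' y powr a * G' x powr b * norm (x - y - s) powr L) \<partial>lborel \<partial>lborel)"
      proof (rule nn_integral_cong_AE, use G(1) in eventually_elim, rule nn_integral_cong_AE,
          use F(1) in eventually_elim)
        fix x y
        assume "G x = ennreal B * ennreal (G' x)" "F y = ennreal A * ennreal (F' y)"
        then have "epowr (F y) a = ennreal (A powr a) * ennreal (F' y powr a)"
          "epowr (G x) b = ennreal (B powr b) * ennreal (G' x powr b)"
          using 4 nn by (auto simp: epowr_mult epowr_ennreal)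
        then show "epowr (F y) a * epowr (G x) b * ennreal (norm (x - y - s) powr L)
          = Q * ennreal (F' y powr a * G' x powr b * norm (x - y - s) powr L)"
          by (simp add: Q_def mult_ac flip: ennreal_mult)
      qed
      also have "\<dots> = Q * (\<integral>\<^sup>+x. \<integral>\<^sup>+y. ennreal (F' y powr a * G' x powr b * norm (x - y - s) powr L) \<partial>lborel \<partial>lborel)"
        by (simp add: nn_integral_cmult)
      also have "\<dots> \<le> Q * ennreal C"
        using nn F(2) G(2) by (intro mult_left_mono CB) auto
      also have "Q = epowr (\<integral>\<^sup>+y. F y \<partial>lborel) a * epowr (\<integral>\<^sup>+x. G x \<partial>lborel) b"
        using 4 by (simp add: Q_def epowr_ennreal ennreal_mult)
      finally show ?thesis by (simp add: mult.commute)
    qed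
  qed
  then show ?thesis using C unfolding hls_bounded_def L_def by blast
qed

subsection \<open>Tensor products and duality\<close>

lemma nn_integral_lborel_pair:
  fixes f :: "'a::euclidean_space \<times> 'b::euclidean_space \<Rightarrow> ennreal"
  assumes "f \<in> borel_measurable borel"
  shows "(\<integral>\<^sup>+z. f z \<partial>lborel) = (\<integral>\<^sup>+x. \<integral>\<^sup>+y. f (x, y) \<partial>lborel \<partial>lborel)"
  using assms unfolding lborel_prod[symmetric] borel_prod[symmetric]
  by (subst lborel.nn_integral_fst) simp_all

text \<open>The second kernel may depend on the first coordinates as long as its constant does not.
  With these frozen, \<open>h2\<close> bounds the inner double integral by powers of the slice
  masses \<open>Ft\<close> and \<open>Gt\<close>, and these masses are the densities to which
  \<open>h1\<close> applies.\<close>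

lemma hls_bounded_prod:
  fixes k1 :: "'a::euclidean_space \<Rightarrow> 'a \<Rightarrow> ennreal"
    and k2 :: "'a \<times> 'b::euclidean_space \<Rightarrow> 'a \<times> 'b \<Rightarrow> ennreal"
  assumes m1: "(\<lambda>(x, y). k1 x y) \<in> borel_measurable borel"
    and m2: "(\<lambda>(x, y). k2 x y) \<in> borel_measurable borel"
    and h1: "hls_bounded a b C1 k1"
    and h2: "\<And>x1 y1. hls_bounded a b C2 (\<lambda>x2 y2. k2 (x1, x2) (y1, y2))"
  shows "hls_bounded a b (C2 * C1) (\<lambda>x y. k1 (fst x) (fst y) * k2 x y)"
  unfolding hls_bounded_def
proof (intro allI impI)
  fix F G :: "'a \<times> 'b \<Rightarrow> ennreal"
  assume m: "F \<in> borel_measurable borel" "G \<in> borel_measurable borel"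
  note [measurable] = m1[unfolded borel_prod[symmetric]] m2[unfolded borel_prod[symmetric]]
    m[unfolded borel_prod[symmetric]]
  define P where "P x y = epowr (F y) a * epowr (G x) b * k2 x y" for x y
  have Pm [measurable]: "(\<lambda>(x, y). P x y) \<in> borel_measurable ((borel \<Otimes>\<^sub>M borel) \<Otimes>\<^sub>M (borel \<Otimes>\<^sub>M borel))"
    unfolding P_def by measurable
  define Ft where "Ft y1 = (\<integral>\<^sup>+y2. F (y1, y2) \<partial>lborel)" for y1
  define Gt where "Gt x1 = (\<integral>\<^sup>+x2. G (x1, x2) \<partial>lborel)" for x1
  have Ftm [measurable]: "Ft \<in> borel_measurable borel" unfolding Ft_def by measurable
  have Gtm [measurable]: "Gt \<in> borel_measurable borel" unfolding Gt_def by measurable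
  have "(\<integral>\<^sup>+x. \<integral>\<^sup>+y. epowr (F y) a * epowr (G x) b * (k1 (fst x) (fst y) * k2 x y) \<partial>lborel \<partial>lborel)
    = (\<integral>\<^sup>+x. \<integral>\<^sup>+y. k1 (fst x) (fst y) * P x y \<partial>lborel \<partial>lborel)"
    by (simp add: P_def mult_ac)
  also have "\<dots> = (\<integral>\<^sup>+x. \<integral>\<^sup>+y1. \<integral>\<^sup>+y2. k1 (fst x) y1 * P x (y1, y2) \<partial>lborel \<partial>lborel \<partial>lborel)"
  proof (intro nn_integral_cong)
    fix x :: "'a \<times> 'b"
    have [simp]: "x \<in> space (borel \<Otimes>\<^sub>M borel)" by (simp add: space_pair_measure)
    have "(\<lambda>y. k1 (fst x) (fst y) * P x y) \<in> borel_measurable borel"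
      unfolding borel_prod[symmetric] by measurable
    then show "(\<integral>\<^sup>+y. k1 (fst x) (fst y) * P x y \<partial>lborel) = (\<integral>\<^sup>+y1. \<integral>\<^sup>+y2. k1 (fst x) y1 * P x (y1, y2) \<partial>lborel \<partial>lborel)"
      by (simp add: nn_integral_lborel_pair)
  qed
  also have "\<dots> = (\<integral>\<^sup>+x1. \<integral>\<^sup>+x2. \<integral>\<^sup>+y1. \<integral>\<^sup>+y2. k1 x1 y1 * P (x1, x2) (y1, y2) \<partial>lborel \<partial>lborel \<partial>lborel \<partial>lborel)"
  proof -
    have "(\<lambda>x. \<integral>\<^sup>+y1. \<integral>\<^sup>+y2. k1 (fst x) y1 * P x (y1, y2) \<partial>lborel \<partial>lborel) \<in> borel_measurable borel"
      unfolding borel_prod[symmetric] by measurable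
    then show ?thesis by (simp add: nn_integral_lborel_pair)
  qed
  \<comment> \<open>Only the two middle variables \<open>x2\<close> and \<open>y1\<close> are
    exchanged, so that both first coordinates stand outside.\<close>
  also have "\<dots> = (\<integral>\<^sup>+x1. \<integral>\<^sup>+y1. \<integral>\<^sup>+x2. \<integral>\<^sup>+y2. k1 x1 y1 * P (x1, x2) (y1, y2) \<partial>lborel \<partial>lborel \<partial>lborel \<partial>lborel)"
    by (intro nn_integral_cong lborel_pair.Fubini') measurable
  also have "\<dots> = (\<integral>\<^sup>+x1. \<integral>\<^sup>+y1. k1 x1 y1 * (\<integral>\<^sup>+x2. \<integral>\<^sup>+y2. P (x1, x2) (y1, y2) \<partial>lborel \<partial>lborel) \<partial>lborel \<partial>lborel)"
    by (simp add: nn_integral_cmult)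
  also have "\<dots> \<le> (\<integral>\<^sup>+x1. \<integral>\<^sup>+y1. k1 x1 y1 * (C2 * (epowr (Ft y1) a * epowr (Gt x1) b)) \<partial>lborel \<partial>lborel)"
  proof (intro nn_integral_mono mult_left_mono)
    fix x1 y1
    have "(\<lambda>y2. F (y1, y2)) \<in> borel_measurable borel" "(\<lambda>x2. G (x1, x2)) \<in> borel_measurable borel"
      by measurable
    then show "(\<integral>\<^sup>+x2. \<integral>\<^sup>+y2. P (x1, x2) (y1, y2) \<partial>lborel \<partial>lborel) \<le> C2 * (epowr (Ft y1) a * epowr (Gt x1) b)"
      using h2[of x1 y1] unfolding hls_bounded_def P_def Ft_def Gt_def by blast
  qed simp
  also have "\<dots> = C2 * (\<integral>\<^sup>+x1. \<integral>\<^sup>+y1. epowr (Ft y1) a * epowr (Gt x1) b * k1 x1 y1 \<partial>lborel \<partial>lborel)"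
    by (simp add: nn_integral_cmult mult.left_commute mult.commute[of "k1 _ _"] mult.assoc flip: nn_integral_cmult)
  also have "\<dots> \<le> C2 * (C1 * (epowr (\<integral>\<^sup>+y1. Ft y1 \<partial>lborel) a * epowr (\<integral>\<^sup>+x1. Gt x1 \<partial>lborel) b))"
    using h1 Ftm Gtm unfolding hls_bounded_def by (intro mult_left_mono) auto
  also have "(\<integral>\<^sup>+y1. Ft y1 \<partial>lborel) = (\<integral>\<^sup>+y. F y \<partial>lborel)"
    using m by (simp add: nn_integral_lborel_pair Ft_def)
  also have "(\<integral>\<^sup>+x1. Gt x1 \<partial>lborel) = (\<integral>\<^sup>+x. G x \<partial>lborel)"
    using m by (simp add: nn_integral_lborel_pair Gt_def)
  finally show "(\<integral>\<^sup>+x. \<integral>\<^sup>+y. epowr (F y) a * epowr (G x) b * (k1 (fst x) (fst y) * k2 x y) \<partial>lborel \<partial>lborel)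
    \<le> C2 * C1 * (epowr (\<integral>\<^sup>+y. F y \<partial>lborel) a * epowr (\<integral>\<^sup>+x. G x \<partial>lborel) b)"
    by (simp add: mult.assoc)
qed

text \<open>Testing against the truncations of \<open>h\<close> to height and radius \<open>k\<close> keeps the quantity that is
  divided out finite.\<close>

lemma nn_integral_epowr_le_by_duality:
  fixes h :: "'a::euclidean_space \<Rightarrow> ennreal"
  assumes [measurable]: "h \<in> borel_measurable borel" and q: "1 < q" and M: "M \<noteq> top"
    and dual: "\<And>G. G \<in> borel_measurable borel \<Longrightarrow>
      (\<integral>\<^sup>+x. epowr (G x) (1 - 1 / q) * h x \<partial>lborel) \<le> M * epowr (\<integral>\<^sup>+x. G x \<partial>lborel) (1 - 1 / q)"
  shows "(\<integral>\<^sup>+x. epowr (h x) q \<partial>lborel) \<le> epowr M q"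
proof -
  define G where "G k x = epowr (min (h x) (of_nat k)) q * indicator (ball 0 (real k)) x" for k x
  have Gm: "G k \<in> borel_measurable borel" for k
    unfolding G_def by (intro borel_measurable_times_ennreal borel_measurable_indicator) auto
  have bound: "(\<integral>\<^sup>+x. G k x \<partial>lborel) \<le> epowr M q" for k
  proof -
    define A where "A = (\<integral>\<^sup>+x. G k x \<partial>lborel)"
    have "A \<le> (\<integral>\<^sup>+x. epowr (of_nat k) q * indicator (ball 0 (real k)) x \<partial>(lborel::'a measure))"
      unfolding A_def G_def using q by (intro nn_integral_mono mult_right_mono epowr_mono) auto
    also have "\<dots> = epowr (of_nat k) q * emeasure lborel (ball (0::'a) (real k))"
      by (intro nn_integral_cmult_indicator) auto
    also have "\<dots> < top"
      using emeasure_lborel_ball_finite[of "0::'a" "real k"]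
      by (simp add: ennreal_mult_eq_top_iff less_top[symmetric])
    finally have Afin: "A < top" .
    have "A \<le> (\<integral>\<^sup>+x. epowr (G k x) (1 - 1 / q) * h x \<partial>lborel)"
      unfolding A_def
    proof (intro nn_integral_mono)
      fix x
      let ?m = "min (h x) (of_nat k)"
      \<comment> \<open>As \<open>q * (1 - 1 / q) = q - 1\<close>, one factor \<open>?m\<close>
        splits off and is bounded by \<open>h x\<close>; the rest is the dual power of
        \<open>G k x\<close>.\<close>
      have "epowr ?m q = epowr ?m (q * (1 - 1 / q)) * epowr ?m 1"
        using q by (subst epowr_add[symmetric]) (simp add: algebra_simps)
      also have "\<dots> \<le> epowr ?m (q * (1 - 1 / q)) * h x" by (intro mult_left_mono) auto
      finally show "G k x \<le> epowr (G k x) (1 - 1 / q) * h x"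
        by (auto simp: G_def epowr_epowr split: split_indicator)
    qed
    also have "\<dots> \<le> M * epowr A (1 - 1 / q)" unfolding A_def by (intro dual Gm)
    finally have le: "A \<le> M * epowr A (1 - 1 / q)" .
    obtain r where r: "A = ennreal r" "0 \<le> r" using Afin by (cases A) auto
    obtain s where s: "M = ennreal s" "0 \<le> s" using M by (cases M) auto
    have "r \<le> s powr q"
    proof (cases "r = 0")
      case False
      with r have "0 < r" by simp
      have "r \<le> s * r powr (1 - 1 / q)"
        using le r s by (simp add: epowr_ennreal flip: ennreal_mult)
      then have "r powr (1 - 1 / q) * r powr (1 / q) \<le> r powr (1 - 1 / q) * s"
        using \<open>0 < r\<close> by (simp add: mult.commute flip: powr_add)
      then have "r powr (1 / q) \<le> s" using \<open>0 < r\<close> by simp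
      then have "(r powr (1 / q)) powr q \<le> s powr q" using q by (intro powr_mono2) auto
      then show ?thesis using q \<open>0 < r\<close> by (simp add: powr_powr)
    qed simp
    then show ?thesis using r s unfolding A_def by (simp add: epowr_ennreal ennreal_leI)
  qed
  have inc: "incseq G"
    unfolding incseq_def le_fun_def G_def using q
    by (auto intro!: epowr_mono min.mono split: split_indicator)
  have sup: "(SUP k. G k x) = epowr (h x) q" for x
  proof (rule antisym)
    show "(SUP k. G k x) \<le> epowr (h x) q"
      using q by (auto intro!: SUP_least epowr_mono simp: G_def split: split_indicator)
    show "epowr (h x) q \<le> (SUP k. G k x)"
    proof (cases "h x")
      case (real r)
      obtain k :: nat where k: "max r (norm x) < real k" using reals_Archimedean2 by blast
      then have "min (h x) (of_nat k) = h x"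
        using real by (auto simp: min_def ennreal_of_nat_eq_real_of_nat)
      then have "epowr (h x) q = G k x" using k by (simp add: G_def)
      then show ?thesis by (metis SUP_upper UNIV_I)
    next
      case top
      have "of_nat i \<le> (SUP k. G k x)" for i :: nat
      proof -
        obtain k0 :: nat where k0: "norm x < real k0" using reals_Archimedean2 by blast
        \<comment> \<open>\<open>k0\<close> puts \<open>x\<close> into the ball, \<open>i\<close>
          gives the size, and 1 makes the power grow with its exponent.\<close>
        define k where "k = max 1 (max i k0)"
        have "real i \<le> real k powr 1" by (simp add: k_def)
        also have "\<dots> \<le> real k powr q" using q by (intro powr_mono) (auto simp: k_def)
        finally have "of_nat i \<le> epowr (of_nat k) q"
          by (simp add: ennreal_of_nat_eq_real_of_nat epowr_ennreal ennreal_leI)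
        also have "\<dots> = G k x" using top k0 by (simp add: G_def k_def)
        also have "\<dots> \<le> (SUP k. G k x)" by (intro SUP_upper) auto
        finally show ?thesis .
      qed
      then have "(SUP k. G k x) = top"
        by (metis ennreal_SUP_of_nat_eq_top SUP_least top_unique)
      then show ?thesis by (simp only: top_greatest)
    qed
  qed
  have "(\<integral>\<^sup>+x. epowr (h x) q \<partial>lborel) = (\<integral>\<^sup>+x. (SUP k. G k x) \<partial>lborel)"
    by (simp add: sup)
  also have "\<dots> = (SUP k. \<integral>\<^sup>+x. G k x \<partial>lborel)"
    using inc Gm by (intro nn_integral_monotone_convergence_SUP) auto
  also have "\<dots> \<le> epowr M q" using bound by (intro SUP_least)
  finally show ?thesis .
qed

subsection \<open>Sufficiency\<close>

lemma hmul_hinv_eq: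
  "hmul \<mu> x (hinv y) = (fst x - fst y, fst (snd x) - fst (snd y),
     snd (snd x) - snd (snd y) - \<mu> * (fst x \<bullet> fst (snd y) - fst (snd x) \<bullet> fst y))"
  by (simp add: hmul_def hinv_def split_beta algebra_simps)

lemma Vker_nonneg [simp]: "0 \<le> Vker \<alpha> \<beta> x"
  by (auto simp: Vker_def Let_def split: prod.splits)

lemma Vker_pos: "u \<noteq> 0 \<Longrightarrow> v \<noteq> 0 \<Longrightarrow> t \<noteq> 0 \<Longrightarrow> 0 < Vker \<alpha> \<beta> (u, v, t)"
  by (auto simp: Vker_def Let_def add_pos_pos intro!: mult_pos_pos powr_gt_zero[THEN iffD2])
    (metis add_pos_pos divide_pos_pos less_irrefl mult_pos_pos zero_less_abs_iff zero_less_norm_iff)+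

lemma measurable_Vker [measurable]: "Vker \<alpha> \<beta> \<in> borel_measurable borel"
  unfolding Vker_def split_beta Let_def borel_prod[symmetric] by measurable

lemma measurable_hmul_hinv [measurable]: "(\<lambda>(x, y). hmul \<mu> x (hinv y)) \<in> borel \<Otimes>\<^sub>M borel \<rightarrow>\<^sub>M borel"
  unfolding borel_prod hmul_hinv_eq split_beta
  by (intro borel_measurable_continuous_onI continuous_intros)

text \<open>The sum \<open>r + 1 / r\<close> dominates both of its terms; the first one compensates
  \<open>r powr s\<close> for nonnegative \<open>s\<close>, the second for negative
  \<open>s\<close>.\<close>

lemma powr_mult_add_inverse_le_one:
  fixes r s :: real
  assumes "0 < r"
  shows "r powr s * (r + 1 / r) powr (- \<bar>s\<bar>) \<le> 1"
proof (cases "0 \<le> s")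
  case True
  then have "r powr s * (r + 1 / r) powr (- \<bar>s\<bar>) \<le> r powr s * r powr (- s)"
    using assms by (intro mult_left_mono) (auto intro!: powr_mono2')
  then show ?thesis using assms by (simp flip: powr_add)
next
  case False
  then have "(r + 1 / r) powr s \<le> (1 / r) powr s"
    using assms by (intro powr_mono2') auto
  then have "r powr s * (r + 1 / r) powr (- \<bar>s\<bar>) \<le> r powr s * (1 / r) powr s"
    using False by (intro mult_left_mono) auto
  also have "\<dots> = 1" using assms by (simp flip: powr_mult)
  finally show ?thesis .
qed

text \<open>The factor \<open>- 1\<close> in the exponent of \<open>\<bar>t\<bar>\<close> is minus
  the dimension of the line, in parallel with \<open>- n\<close>; all three factors thus have the
  shape treated by \<open>hls_bounded_norm_powr\<close>.\<close>

lemma Vker_le_product: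
  fixes u v :: "real^'n::finite"
  assumes \<gamma>: "\<gamma> = (\<alpha> + \<beta>) / (real CARD('n) + 1)"
  defines "n \<equiv> real CARD('n)"
  shows "Vker \<alpha> \<beta> (u, v, t) \<le> norm u powr (- n * (1 - \<gamma>)) * (norm v powr (- n * (1 - \<gamma>)) * \<bar>t\<bar> powr (- 1 * (1 - \<gamma>)))"
proof (cases "u = 0 \<or> v = 0 \<or> t = 0")
  case True
  then show ?thesis by (simp add: Vker_def Let_def)
next
  case False
  define A B T where "A = norm u" and "B = norm v" and "T = \<bar>t\<bar>"
  have pos: "0 < A" "0 < B" "0 < T" using False by (auto simp: A_def B_def T_def)
  define r where "r = A * B / T"
  have r: "0 < r" using pos by (simp add: r_def)
  define \<sigma> where "\<sigma> = (\<alpha> - n * \<beta>) / (n + 1)"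
  have n: "0 < n + 1" by (simp add: n_def add_nonneg_pos)
  \<comment> \<open>Both identities express that \<alpha> - n \<gamma> = \<sigma> and \<beta> -
    \<gamma> = -\<sigma>. The surplus powers of \<open>A\<close>, \<open>B\<close> and
    \<open>T\<close> then combine to \<open>r powr \<sigma>\<close>.\<close>
  have e1: "\<alpha> - n = - n * (1 - \<gamma>) + \<sigma>"
    using n unfolding \<gamma> \<sigma>_def n_def[symmetric] by (simp add: divide_simps) (simp add: algebra_simps)
  have e2: "\<beta> - 1 = - 1 * (1 - \<gamma>) - \<sigma>"
    using n unfolding \<gamma> \<sigma>_def n_def[symmetric] by (simp add: divide_simps) (simp add: algebra_simps)
  have "\<bar>\<alpha> - n * \<beta>\<bar> / (n + 1) = \<bar>\<sigma>\<bar>" using n by (simp add: \<sigma>_def)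
  moreover have "T / (A * B) = 1 / r" by (simp add: r_def)
  ultimately have "Vker \<alpha> \<beta> (u, v, t) =
      A powr (\<alpha> - n) * B powr (\<alpha> - n) * T powr (\<beta> - 1) * (r + 1 / r) powr (- \<bar>\<sigma>\<bar>)"
    using False by (simp add: Vker_def Let_def n_def A_def B_def T_def r_def)
  also have "\<dots> = (A powr (- n * (1 - \<gamma>)) * (B powr (- n * (1 - \<gamma>)) * T powr (- 1 * (1 - \<gamma>))))
      * (r powr \<sigma> * (r + 1 / r) powr (- \<bar>\<sigma>\<bar>))"
    unfolding e1 e2 powr_add powr_diff using pos by (simp add: r_def powr_divide powr_mult)
  also have "\<dots> \<le> (A powr (- n * (1 - \<gamma>)) * (B powr (- n * (1 - \<gamma>)) * T powr (- 1 * (1 - \<gamma>)))) * 1"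
    using r by (intro mult_left_mono powr_mult_add_inverse_le_one) auto
  finally show ?thesis by (simp add: A_def B_def T_def)
qed

text \<open>Two applications of \<open>hls_bounded_prod\<close> peel off the first and the second
  coordinate pair. Once these are frozen, the twist is a constant shift in the last variable, and
  the one-dimensional bound is uniform in such shifts.\<close>

lemma hls_bounded_twisted_product:
  fixes a b \<mu> :: real
  assumes ab: "a < 1" "b < 1" "1 < a + b"
  defines "n \<equiv> real CARD('n::finite)" and "c \<equiv> 2 - a - b"
  shows "\<exists>C>0. hls_bounded a b (ennreal C) (\<lambda>(x :: 'n heis) y.
    ennreal (norm (fst x - fst y) powr (- n * c)) *
    (ennreal (norm (fst (snd x) - fst (snd y)) powr (- n * c)) *
     ennreal (norm (snd (snd x) - snd (snd y) - \<mu> * (fst x \<bullet> fst (snd y) - fst (snd x) \<bullet> fst y)) powr (- 1 * c))))"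
proof -
  define k1 :: "real^'n \<Rightarrow> real^'n \<Rightarrow> ennreal" where "k1 u \<xi> = ennreal (norm (u - \<xi>) powr (- n * c))" for u \<xi>
  define k3 :: "real^'n \<Rightarrow> real^'n \<Rightarrow> (real^'n) \<times> real \<Rightarrow> (real^'n) \<times> real \<Rightarrow> ennreal" where
    "k3 u \<xi> z w = ennreal (norm (snd z - snd w - \<mu> * (u \<bullet> fst w - fst z \<bullet> \<xi>)) powr (- 1 * c))" for u \<xi> z w
  obtain C1 where C1: "C1 > 0" "\<And>s::real^'n. hls_bounded a b (ennreal C1) (\<lambda>x y. ennreal (norm (x - y - s) powr (- n * c)))"
    using hls_bounded_norm_powr[OF ab, where 'a="real^'n"] unfolding n_def c_def by auto
  obtain C3 where C3: "C3 > 0" "\<And>s::real. hls_bounded a b (ennreal C3) (\<lambda>x y. ennreal (norm (x - y - s) powr (- 1 * c)))"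
    using hls_bounded_norm_powr[OF ab, where 'a=real] unfolding n_def c_def by auto
  have k1: "hls_bounded a b (ennreal C1) k1" using C1(2)[of 0] unfolding k1_def by simp
  have k1m: "(\<lambda>(x, y). k1 x y) \<in> borel_measurable borel"
    unfolding k1_def borel_prod[symmetric] by measurable
  have k3m: "(\<lambda>(z, w). k3 u \<xi> z w) \<in> borel_measurable borel" for u \<xi>
    unfolding k3_def split_beta
    by (intro measurable_compose[OF _ measurable_ennreal] powr_real_measurable borel_measurable_const
        borel_measurable_continuous_onI continuous_intros)
  have k13: "hls_bounded a b (ennreal C3 * ennreal C1) (\<lambda>z w. k1 (fst z) (fst w) * k3 u \<xi> z w)" for u \<xi>
    by (rule hls_bounded_prod[OF k1m k3m k1]) (simp only: k3_def fst_conv snd_conv C3(2))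
  have "hls_bounded a b (ennreal C3 * ennreal C1 * ennreal C1)
      (\<lambda>x y. k1 (fst x) (fst y) * (k1 (fst (snd x)) (fst (snd y)) * k3 (fst x) (fst y) (snd x) (snd y)))"
  proof (rule hls_bounded_prod[OF k1m _ k1])
    show "(\<lambda>(x, y). k1 (fst (snd x)) (fst (snd y)) * k3 (fst x) (fst y) (snd x) (snd y)) \<in> borel_measurable borel"
      unfolding k1_def k3_def split_beta
      by (intro borel_measurable_times_ennreal measurable_compose[OF _ measurable_ennreal] powr_real_measurable borel_measurable_const
        borel_measurable_continuous_onI continuous_intros)
    show "hls_bounded a b (ennreal C3 * ennreal C1)
      (\<lambda>x2 y2. k1 (fst (snd (x1, x2))) (fst (snd (y1, y2))) * k3 (fst (x1, x2)) (fst (y1, y2)) (snd (x1, x2)) (snd (y1, y2)))" for x1 y1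
      using k13[of x1 y1] by simp
  qed
  then show ?thesis using C1(1) C3(1) unfolding k1_def k3_def
    by (intro exI[of _ "C3 * C1 * C1"]) (auto simp: ennreal_mult)
qed

text \<open>With \<open>a = 1 / p\<close> and \<open>b = 1 - 1 / q\<close>, the condition
  \<open>1 < a + b\<close> says \<open>p < q\<close>, and \<open>2 - a - b\<close> equals 1 -
  \<gamma>. Duality is applied to \<open>h\<close>, the operator acting on the absolute value of
  \<open>f\<close>; one bound then yields convergence, membership in L^q and the norm
  estimate.\<close>

lemma Iab_bounded:
  fixes \<mu> \<alpha> \<beta> p q :: real
  assumes pq: "1 < p" "p < q" and hom: "(\<alpha> + \<beta>) / (real CARD('n) + 1) = 1 / p - 1 / q"
  shows "\<exists>B>0. \<forall>f :: 'n::finite heis \<Rightarrow> real. inLp p f \<longrightarrow>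
            (AE x in lborel. integrable lborel (\<lambda>y. f y * Vker \<alpha> \<beta> (hmul \<mu> x (hinv y)))) \<and>
            inLp q (Iab \<mu> \<alpha> \<beta> f) \<and>
            Lpnorm q (Iab \<mu> \<alpha> \<beta> f) \<le> B * Lpnorm p f"
proof -
  define n where "n = real CARD('n)"
  define a b where "a = 1 / p" and "b = 1 - 1 / q"
  define K where "K x y = Vker \<alpha> \<beta> (hmul \<mu> x (hinv y))" for x y :: "'n heis"
  have ab: "a < 1" "b < 1" "1 < a + b" using pq by (auto simp: a_def b_def frac_less2)
  have c: "1 - (1 / p - 1 / q) = 2 - a - b" by (simp add: a_def b_def)
  have Km [measurable]: "(\<lambda>(x, y). K x y) \<in> borel_measurable (borel \<Otimes>\<^sub>M borel)"
    unfolding K_def by measurable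
  define W where "W x y = ennreal (norm (fst x - fst y) powr (- n * (2 - a - b))) *
    (ennreal (norm (fst (snd x) - fst (snd y)) powr (- n * (2 - a - b))) *
     ennreal (norm (snd (snd x) - snd (snd y) - \<mu> * (fst x \<bullet> fst (snd y) - fst (snd x) \<bullet> fst y)) powr (- 1 * (2 - a - b))))"
    for x y :: "'n heis"
  obtain C where C: "C > 0" and hls: "hls_bounded a b (ennreal C) W"
    using hls_bounded_twisted_product[OF ab, where 'n='n and \<mu>=\<mu>] unfolding n_def W_def by blast
  have KW: "ennreal (K x y) \<le> W x y" for x y
    using ennreal_leI[OF Vker_le_product[OF hom[symmetric]]]
    unfolding K_def W_def hmul_hinv_eq c n_def by (simp add: ennreal_mult)
  have "(AE x in lborel. integrable lborel (\<lambda>y. f y * K x y)) \<and>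
        inLp q (Iab \<mu> \<alpha> \<beta> f) \<and> Lpnorm q (Iab \<mu> \<alpha> \<beta> f) \<le> C * Lpnorm p f"
    if f: "inLp p f" for f :: "'n heis \<Rightarrow> real"
  proof -
    have fm [measurable]: "f \<in> borel_measurable borel" and fi: "integrable lborel (\<lambda>x. \<bar>f x\<bar> powr p)"
      using f by (auto simp: inLp_def)
    define F where "F y = ennreal (\<bar>f y\<bar> powr p)" for y
    have [measurable]: "F \<in> borel_measurable borel" unfolding F_def by measurable
    define A where "A = (\<integral>x. \<bar>f x\<bar> powr p \<partial>lborel)"
    have A: "0 \<le> A" "(\<integral>\<^sup>+y. F y \<partial>lborel) = ennreal A"
      unfolding A_def F_def using fi by (auto intro!: nn_integral_eq_integral)
    have Fa: "epowr (F y) a = ennreal \<bar>f y\<bar>" for y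
      using pq by (simp add: F_def a_def epowr_ennreal powr_powr)
    define h where "h x = (\<integral>\<^sup>+y. ennreal \<bar>f y\<bar> * ennreal (K x y) \<partial>lborel)" for x
    have hm [measurable]: "h \<in> borel_measurable borel" unfolding h_def by measurable
    define M where "M = ennreal (C * A powr a)"
    have "(\<integral>\<^sup>+x. epowr (h x) q \<partial>lborel) \<le> epowr M q"
    proof (rule nn_integral_epowr_le_by_duality)
      fix G :: "'n heis \<Rightarrow> ennreal" assume G [measurable]: "G \<in> borel_measurable borel"
      have "(\<integral>\<^sup>+x. epowr (G x) b * h x \<partial>lborel)
          = (\<integral>\<^sup>+x. \<integral>\<^sup>+y. epowr (G x) b * (ennreal \<bar>f y\<bar> * ennreal (K x y)) \<partial>lborel \<partial>lborel)"
        unfolding h_def by (simp add: nn_integral_cmult)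
      also have "\<dots> \<le> (\<integral>\<^sup>+x. \<integral>\<^sup>+y. epowr (F y) a * epowr (G x) b * W x y \<partial>lborel \<partial>lborel)"
        unfolding Fa using KW
        by (intro nn_integral_mono) (auto simp: mult.assoc mult.left_commute intro!: mult_left_mono)
      also have "\<dots> \<le> ennreal C * (epowr (\<integral>\<^sup>+y. F y \<partial>lborel) a * epowr (\<integral>\<^sup>+x. G x \<partial>lborel) b)"
        using hls by (simp add: hls_bounded_def)
      also have "\<dots> = M * epowr (\<integral>\<^sup>+x. G x \<partial>lborel) b"
        using A C by (simp add: M_def epowr_ennreal ennreal_mult mult.assoc)
      finally show "(\<integral>\<^sup>+x. epowr (G x) (1 - 1 / q) * h x \<partial>lborel) \<le> M * epowr (\<integral>\<^sup>+x. G x \<partial>lborel) (1 - 1 / q)"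
        unfolding b_def .
    qed (use pq in \<open>auto simp: M_def\<close>)
    also have "\<dots> = ennreal ((C * A powr a) powr q)" using C by (simp add: M_def epowr_ennreal)
    finally have hq: "(\<integral>\<^sup>+x. epowr (h x) q \<partial>lborel) \<le> ennreal ((C * A powr a) powr q)" .
    \<comment> \<open>A finite integral makes \<open>h\<close> finite almost everywhere, which is
      absolute convergence of the integral defining the operator.\<close>
    then have "AE x in lborel. epowr (h x) q \<noteq> \<infinity>"
      by (intro nn_integral_PInf_AE) (auto simp: top_unique)
    then have "AE x in lborel. h x < \<infinity>" by eventually_elim (auto simp: less_top)
    then have int: "AE x in lborel. integrable lborel (\<lambda>y. f y * K x y)"
    proof eventually_elim
      case (elim x)
      then show ?case
        by (intro integrableI_bounded) (auto simp: h_def abs_mult ennreal_mult K_def)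
    qed
    have I: "Iab \<mu> \<alpha> \<beta> f x = (\<integral>y. f y * K x y \<partial>lborel)" for x by (simp add: Iab_def K_def)
    have Im [measurable]: "Iab \<mu> \<alpha> \<beta> f \<in> borel_measurable borel"
      unfolding I[abs_def] by measurable
    \<comment> \<open>This holds at every \<open>x\<close>: where the integrand is not integrable,
      its Bochner integral is 0 by convention.\<close>
    have Ih: "ennreal \<bar>Iab \<mu> \<alpha> \<beta> f x\<bar> \<le> h x" for x
    proof (cases "integrable lborel (\<lambda>y. f y * K x y)")
      case True
      then show ?thesis using integral_norm_bound_ennreal[OF True]
        by (simp add: I h_def abs_mult ennreal_mult K_def)
    qed (simp add: I not_integrable_integral_eq)
    have Iq: "(\<integral>\<^sup>+x. ennreal (\<bar>Iab \<mu> \<alpha> \<beta> f x\<bar> powr q) \<partial>lborel) \<le> ennreal ((C * A powr a) powr q)"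
    proof -
      have "(\<integral>\<^sup>+x. ennreal (\<bar>Iab \<mu> \<alpha> \<beta> f x\<bar> powr q) \<partial>lborel) \<le> (\<integral>\<^sup>+x. epowr (h x) q \<partial>lborel)"
      proof (intro nn_integral_mono)
        fix x
        show "ennreal (\<bar>Iab \<mu> \<alpha> \<beta> f x\<bar> powr q) \<le> epowr (h x) q"
          using epowr_mono[OF Ih, of q x] pq by (simp add: epowr_ennreal)
      qed
      then show ?thesis using hq by (rule order_trans)
    qed
    have Ii: "integrable lborel (\<lambda>x. \<bar>Iab \<mu> \<alpha> \<beta> f x\<bar> powr q)"
      using Iq by (intro integrableI_bounded) (auto simp: less_top[symmetric] top_unique)
    have "ennreal (\<integral>x. \<bar>Iab \<mu> \<alpha> \<beta> f x\<bar> powr q \<partial>lborel) \<le> ennreal ((C * A powr a) powr q)"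
      using Iq Ii by (simp add: nn_integral_eq_integral)
    then have "(\<integral>x. \<bar>Iab \<mu> \<alpha> \<beta> f x\<bar> powr q \<partial>lborel) \<le> (C * A powr a) powr q"
      by (simp add: ennreal_le_iff)
    then have "Lpnorm q (Iab \<mu> \<alpha> \<beta> f) \<le> ((C * A powr a) powr q) powr (1 / q)"
      unfolding Lpnorm_def using pq by (intro powr_mono2) auto
    also have "\<dots> = C * Lpnorm p f"
      using pq C by (simp add: powr_powr Lpnorm_def A_def a_def)
    finally show ?thesis using int Ii Im by (simp add: inLp_def)
  qed
  then show ?thesis using C unfolding K_def by blast
qed

subsection \<open>Necessity\<close>

definition hdil :: "real \<Rightarrow> 'n::finite heis \<Rightarrow> 'n heis" where
  "hdil r x = (r *\<^sub>R fst x, r *\<^sub>R fst (snd x), r\<^sup>2 * snd (snd x))"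

lemma measurable_hdil [measurable]: "hdil r \<in> borel \<rightarrow>\<^sub>M borel"
  unfolding hdil_def by (intro borel_measurable_continuous_onI continuous_intros)

lemma nn_integral_lborel_scaleR:
  fixes f :: "'a::euclidean_space \<Rightarrow> ennreal"
  assumes [measurable]: "f \<in> borel_measurable borel" and "0 < c"
  shows "(\<integral>\<^sup>+x. f x \<partial>lborel) = ennreal (c ^ DIM('a)) * (\<integral>\<^sup>+x. f (c *\<^sub>R x) \<partial>lborel)"
proof -
  have "(\<integral>\<^sup>+x. f x \<partial>lborel) = (\<integral>\<^sup>+x. f x \<partial>density (distr lborel borel (\<lambda>x. 0 + c *\<^sub>R x)) (\<lambda>_. ennreal (\<bar>c\<bar> ^ DIM('a))))"
    using assms by (subst lborel_affine[of c 0]) auto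
  also have "\<dots> = (\<integral>\<^sup>+x. ennreal (c ^ DIM('a)) * f (c *\<^sub>R x) \<partial>lborel)"
    using assms by (simp add: nn_integral_density nn_integral_distr)
  finally show ?thesis by (simp add: nn_integral_cmult)
qed

text \<open>The Jacobian collects \<open>r ^ n\<close> from each of the two vector coordinates and
  \<open>r\<^sup>2\<close> from the last one, by scaling one variable at a time in the iterated
  integral.\<close>

lemma nn_integral_lborel_hdil:
  fixes f :: "'n::finite heis \<Rightarrow> ennreal"
  assumes f: "f \<in> borel_measurable borel" and r: "0 < r"
  shows "(\<integral>\<^sup>+x. f (hdil r x) \<partial>lborel) = ennreal (r powr (- 2 * (real CARD('n) + 1))) * (\<integral>\<^sup>+x. f x \<partial>lborel)"
proof -
  note [measurable] = f[unfolded borel_prod[symmetric]]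
  have fh: "(\<lambda>x. f (hdil r x)) \<in> borel_measurable borel" using f by measurable
  note [measurable] = fh[unfolded borel_prod[symmetric]]
  have iter: "(\<integral>\<^sup>+x. g x \<partial>lborel) = (\<integral>\<^sup>+u. \<integral>\<^sup>+v. \<integral>\<^sup>+t. g (u, v, t) \<partial>lborel \<partial>lborel \<partial>lborel)"
    if "g \<in> borel_measurable borel" for g :: "'n heis \<Rightarrow> ennreal"
  proof -
    note [measurable] = that[unfolded borel_prod[symmetric]]
    have "(\<integral>\<^sup>+z. g (u, z) \<partial>lborel) = (\<integral>\<^sup>+v. \<integral>\<^sup>+t. g (u, v, t) \<partial>lborel \<partial>lborel)" for u
      by (rule nn_integral_lborel_pair) (simp flip: borel_prod)
    then show ?thesis using that by (simp add: nn_integral_lborel_pair)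
  qed
  define n where "n = CARD('n)"
  have "(\<integral>\<^sup>+x. f x \<partial>lborel) = (\<integral>\<^sup>+u. \<integral>\<^sup>+v. \<integral>\<^sup>+t. f (u, v, t) \<partial>lborel \<partial>lborel \<partial>lborel)"
    by (rule iter[OF f])
  also have "\<dots> = (\<integral>\<^sup>+u. \<integral>\<^sup>+v. ennreal (r\<^sup>2) * (\<integral>\<^sup>+t. f (u, v, r\<^sup>2 * t) \<partial>lborel) \<partial>lborel \<partial>lborel)"
  proof (intro nn_integral_cong)
    fix u v
    show "(\<integral>\<^sup>+t. f (u, v, t) \<partial>lborel) = ennreal (r\<^sup>2) * (\<integral>\<^sup>+t. f (u, v, r\<^sup>2 * t) \<partial>lborel)"
      using r nn_integral_lborel_scaleR[of "\<lambda>t. f (u, v, t)" "r\<^sup>2"] by simp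
  qed
  also have "\<dots> = ennreal (r\<^sup>2) * (\<integral>\<^sup>+u. \<integral>\<^sup>+v. \<integral>\<^sup>+t. f (u, v, r\<^sup>2 * t) \<partial>lborel \<partial>lborel \<partial>lborel)"
    by (simp add: nn_integral_cmult)
  also have "\<dots> = ennreal (r\<^sup>2) * (\<integral>\<^sup>+u. ennreal (r ^ n) * (\<integral>\<^sup>+v. \<integral>\<^sup>+t. f (u, r *\<^sub>R v, r\<^sup>2 * t) \<partial>lborel \<partial>lborel) \<partial>lborel)"
  proof (intro arg_cong[where f="\<lambda>z. ennreal (r\<^sup>2) * z"] nn_integral_cong)
    fix u
    show "(\<integral>\<^sup>+v. \<integral>\<^sup>+t. f (u, v, r\<^sup>2 * t) \<partial>lborel \<partial>lborel) = ennreal (r ^ n) * (\<integral>\<^sup>+v. \<integral>\<^sup>+t. f (u, r *\<^sub>R v, r\<^sup>2 * t) \<partial>lborel \<partial>lborel)"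
      using r nn_integral_lborel_scaleR[of "\<lambda>v. \<integral>\<^sup>+t. f (u, v, r\<^sup>2 * t) \<partial>lborel" r] by (simp add: n_def)
  qed
  also have "\<dots> = ennreal (r\<^sup>2) * (ennreal (r ^ n) * (\<integral>\<^sup>+u. \<integral>\<^sup>+v. \<integral>\<^sup>+t. f (u, r *\<^sub>R v, r\<^sup>2 * t) \<partial>lborel \<partial>lborel \<partial>lborel))"
    by (simp add: nn_integral_cmult)
  also have "(\<integral>\<^sup>+u. \<integral>\<^sup>+v. \<integral>\<^sup>+t. f (u, r *\<^sub>R v, r\<^sup>2 * t) \<partial>lborel \<partial>lborel \<partial>lborel)
      = ennreal (r ^ n) * (\<integral>\<^sup>+u. \<integral>\<^sup>+v. \<integral>\<^sup>+t. f (r *\<^sub>R u, r *\<^sub>R v, r\<^sup>2 * t) \<partial>lborel \<partial>lborel \<partial>lborel)"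
    using r nn_integral_lborel_scaleR[of "\<lambda>u. \<integral>\<^sup>+v. \<integral>\<^sup>+t. f (u, r *\<^sub>R v, r\<^sup>2 * t) \<partial>lborel \<partial>lborel" r] by (simp add: n_def)
  also have "(\<integral>\<^sup>+u. \<integral>\<^sup>+v. \<integral>\<^sup>+t. f (r *\<^sub>R u, r *\<^sub>R v, r\<^sup>2 * t) \<partial>lborel \<partial>lborel \<partial>lborel) = (\<integral>\<^sup>+x. f (hdil r x) \<partial>lborel)"
    using iter[OF fh] by (simp add: hdil_def)
  finally have "(\<integral>\<^sup>+x. f x \<partial>lborel) = ennreal (r\<^sup>2 * r ^ n * r ^ n) * (\<integral>\<^sup>+x. f (hdil r x) \<partial>lborel)"
    using r by (simp add: ennreal_mult mult.assoc)
  moreover have "r\<^sup>2 * r ^ n * r ^ n = r powr (2 * (real n + 1))"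
  proof -
    have "r\<^sup>2 * r ^ n * r ^ n = r powr (2 + real n + real n)"
      using r by (simp only: powr_add powr_realpow powr_numeral)
    then show ?thesis by (simp add: algebra_simps)
  qed
  ultimately have scaled: "(\<integral>\<^sup>+x. f x \<partial>lborel) = ennreal (r powr (2 * (real n + 1))) * (\<integral>\<^sup>+x. f (hdil r x) \<partial>lborel)"
    by (simp only:)
  have "ennreal (r powr (- 2 * (real n + 1))) * (\<integral>\<^sup>+x. f x \<partial>lborel)
      = ennreal (r powr (- 2 * (real n + 1)) * r powr (2 * (real n + 1))) * (\<integral>\<^sup>+x. f (hdil r x) \<partial>lborel)"
    by (simp only: scaled ennreal_mult powr_ge_zero mult.assoc)
  also have "r powr (- 2 * (real n + 1)) * r powr (2 * (real n + 1)) = 1"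
    using r by (simp flip: powr_add)
  finally show ?thesis by (simp add: n_def)
qed

text \<open>The ratio of |u||v| to |t| is invariant, so only the three power factors scale, with
  total exponent 2(\<alpha> - n) + 2(\<beta> - 1).\<close>

lemma Vker_hdil:
  fixes x :: "'n::finite heis"
  assumes "0 < r"
  shows "Vker \<alpha> \<beta> (hdil r x) = r powr (2 * (\<alpha> + \<beta> - real CARD('n) - 1)) * Vker \<alpha> \<beta> x"
proof -
  obtain u v t where x: "x = (u, v, t)" by (cases x)
  define n where "n = real CARD('n)"
  define \<rho> where "\<rho> = \<bar>\<alpha> - n * \<beta>\<bar> / (n + 1)"
  have "norm (r *\<^sub>R u) powr (\<alpha> - n) * norm (r *\<^sub>R v) powr (\<alpha> - n) * \<bar>r\<^sup>2 * t\<bar> powr (\<beta> - 1)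
     = (r powr (\<alpha> - n) * r powr (\<alpha> - n) * (r powr 2) powr (\<beta> - 1)) * (norm u powr (\<alpha> - n) * norm v powr (\<alpha> - n) * \<bar>t\<bar> powr (\<beta> - 1))"
    using assms by (simp add: powr_mult abs_mult powr_numeral)
  also have "r powr (\<alpha> - n) * r powr (\<alpha> - n) * (r powr 2) powr (\<beta> - 1) = r powr (2 * (\<alpha> + \<beta> - n - 1))"
    by (simp add: powr_powr algebra_simps flip: powr_add)
  moreover have "norm (r *\<^sub>R u) * norm (r *\<^sub>R v) / \<bar>r\<^sup>2 * t\<bar> = norm u * norm v / \<bar>t\<bar>"
    "\<bar>r\<^sup>2 * t\<bar> / (norm (r *\<^sub>R u) * norm (r *\<^sub>R v)) = \<bar>t\<bar> / (norm u * norm v)"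
    using assms by (auto simp: abs_mult power2_eq_square field_simps)
  ultimately show ?thesis
    using assms unfolding x hdil_def Vker_def Let_def n_def[symmetric]
    by (simp only: fst_conv snd_conv prod.case scaleR_eq_0_iff mult_eq_0_iff power_eq_0_iff) auto
qed

text \<open>The twist is bilinear and so scales by \<open>r\<^sup>2\<close>, exactly as the last
  coordinate does.\<close>

lemma hmul_hinv_hdil: "hmul \<mu> (hdil r x) (hinv (hdil r y)) = hdil r (hmul \<mu> x (hinv y))"
  by (simp add: hmul_hinv_eq hdil_def power2_eq_square algebra_simps)

section \<open>The image of the unit ball's indicator is not zero\<close>

lemma AE_lborel_notin_open:
  fixes U :: "'a::euclidean_space set"
  assumes "open U" "AE x in lborel. x \<notin> U"
  shows "U = {}"
proof (rule ccontr)
  assume "U \<noteq> {}"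
  then obtain c e where e: "0 < e" "ball c e \<subseteq> U"
    using assms(1) by (meson ex_in_conv open_contains_ball)
  have "AE x in lborel. x \<notin> ball c e"
    using assms(2) by eventually_elim (use e in auto)
  then have "emeasure lborel (ball c e) = 0"
    by (subst (asm) AE_iff_measurable[of "ball c e"]) auto
  moreover have "emeasure lborel (ball c e) = ennreal (unit_ball_vol (real DIM('a)) * e ^ DIM('a))"
    using e by (intro emeasure_ball) auto
  moreover have "0 < unit_ball_vol (real DIM('a)) * e ^ DIM('a)" using e by simp
  ultimately show False by (simp add: ennreal_eq_0_iff)
qed

text \<open>Far from the unit ball none of the coordinates of \<open>x \<odot> y\<inverse>\<close> vanish, so no
  null-set argument in \<open>y\<close> is needed.\<close>

lemma nn_integral_Vker_ball_pos:
  fixes \<mu> \<alpha> \<beta> :: real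
  defines "J \<equiv> \<lambda>x :: 'n::finite heis. \<integral>\<^sup>+y. ennreal (indicator (ball 0 1) y * Vker \<alpha> \<beta> (hmul \<mu> x (hinv y))) \<partial>lborel"
  shows "\<not> (AE x in lborel. J x = 0)"
proof
  assume ae: "AE x in lborel. J x = 0"
  \<comment> \<open>For \<open>y\<close> in the unit ball, the first two bounds keep the vector
    coordinates of \<open>x\<close> and \<open>y\<close> apart. The third exceeds the last
    coordinate of \<open>y\<close> plus the largest possible twist.\<close>
  define U where "U = {x :: 'n heis. 1 < norm (fst x) \<and> 1 < norm (fst (snd x)) \<and>
    1 + \<bar>\<mu>\<bar> * (norm (fst x) + norm (fst (snd x))) < snd (snd x)}"
  have "open U"
    unfolding U_def by (intro open_Collect_conj open_Collect_less continuous_intros)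
  have "J x \<noteq> 0" if x: "x \<in> U" for x
  proof
    assume "J x = 0"
    have m: "(\<lambda>y. Vker \<alpha> \<beta> (hmul \<mu> x (hinv y))) \<in> borel_measurable borel" by measurable
    have "(\<lambda>y. ennreal (indicator (ball 0 1) y * Vker \<alpha> \<beta> (hmul \<mu> x (hinv y)))) \<in> borel_measurable borel"
      by (intro measurable_compose[OF _ measurable_ennreal] borel_measurable_times borel_measurable_indicator m) auto
    with \<open>J x = 0\<close> have zero: "AE y in lborel. ennreal (indicator (ball 0 1) y * Vker \<alpha> \<beta> (hmul \<mu> x (hinv y))) = 0"
      unfolding J_def by (subst (asm) nn_integral_0_iff_AE) auto
    have pos: "0 < Vker \<alpha> \<beta> (hmul \<mu> x (hinv y))" if y: "y \<in> ball 0 1" for y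
    proof -
      have ny: "norm y < 1" using y by simp
      have n1: "norm (fst y) \<le> norm y" using norm_fst_le[of "fst y" "snd y"] by simp
      have n2: "norm (snd y) \<le> norm y" using norm_snd_le[of "snd y" "fst y"] by simp
      have n3: "norm (fst (snd y)) \<le> norm (snd y)" using norm_fst_le[of "fst (snd y)" "snd (snd y)"] by simp
      have n4: "norm (snd (snd y)) \<le> norm (snd y)" using norm_snd_le[of "snd (snd y)" "fst (snd y)"] by simp
      have ne: "fst x \<noteq> fst y" "fst (snd x) \<noteq> fst (snd y)"
        using x ny n1 n2 n3 by (auto simp: U_def)
      have "\<bar>fst x \<bullet> fst (snd y)\<bar> \<le> norm (fst x) * 1"
        using Cauchy_Schwarz_ineq2[of "fst x" "fst (snd y)"] ny n2 n3
        by (meson mult_left_mono norm_ge_zero order_trans less_imp_le)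
      moreover have "\<bar>fst (snd x) \<bullet> fst y\<bar> \<le> norm (fst (snd x)) * 1"
        using Cauchy_Schwarz_ineq2[of "fst (snd x)" "fst y"] ny n1
        by (meson mult_left_mono norm_ge_zero order_trans less_imp_le)
      ultimately have "\<bar>fst x \<bullet> fst (snd y) - fst (snd x) \<bullet> fst y\<bar> \<le> norm (fst x) + norm (fst (snd x))"
        by linarith
      then have "\<bar>\<mu> * (fst x \<bullet> fst (snd y) - fst (snd x) \<bullet> fst y)\<bar> \<le> \<bar>\<mu>\<bar> * (norm (fst x) + norm (fst (snd x)))"
        unfolding abs_mult by (intro mult_left_mono) auto
      moreover have "1 + \<bar>\<mu>\<bar> * (norm (fst x) + norm (fst (snd x))) < snd (snd x)" using x by (simp add: U_def)
      ultimately have "snd (snd x) - snd (snd y) - \<mu> * (fst x \<bullet> fst (snd y) - fst (snd x) \<bullet> fst y) \<noteq> 0"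
        using n2 n4 ny unfolding real_norm_def by linarith
      then show ?thesis unfolding hmul_hinv_eq using ne by (intro Vker_pos) auto
    qed
    from zero have "AE y in lborel. y \<notin> ball (0 :: 'n heis) 1"
    proof eventually_elim
      case (elim y)
      show ?case
      proof
        assume y: "y \<in> ball 0 1"
        show False using elim pos[OF y] unfolding indicator_simps(1)[OF y] by (simp add: ennreal_eq_0_iff)
      qed
    qed
    then show False using AE_lborel_notin_open[of "ball (0 :: 'n heis) 1"] by auto
  qed
  then have "AE x in lborel. x \<notin> U" using ae by (auto elim!: eventually_mono)
  then have "U = {}" using \<open>open U\<close> by (intro AE_lborel_notin_open)
  \<comment> \<open>With both norms equal to 2, the third condition reads 1 + 4|\<mu>| < 2 +
    4|\<mu>|.\<close>
  moreover obtain u :: "real^'n" where "norm u = 2" using vector_choose_size[of 2] by auto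
  then have "(u, u, 2 + \<bar>\<mu>\<bar> * 4) \<in> U" by (simp add: U_def)
  ultimately show False by auto
qed

text \<open>For nonzero \<open>E\<close> the value \<open>M + 1\<close> is attained at
  \<open>r = (M + 1) powr (1 / E)\<close>. Taking \<open>r = 1\<close> first shows that
  \<open>M + 1\<close> is positive.\<close>

lemma powr_bounded_imp_zero:
  fixes E M :: real
  assumes "\<And>r. 0 < r \<Longrightarrow> r powr E \<le> M"
  shows "E = 0"
proof (rule ccontr)
  assume "E \<noteq> 0"
  have "1 \<le> M" using assms[of 1] by simp
  then have "((M + 1) powr (1 / E)) powr E = M + 1" using \<open>E \<noteq> 0\<close> by (simp add: powr_powr)
  moreover have "((M + 1) powr (1 / E)) powr E \<le> M" using \<open>1 \<le> M\<close> by (intro assms) auto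
  ultimately show False by simp
qed

text \<open>The bound is tested on the dilates \<open>f r\<close> of the ball indicator. Raised to
  the power \<open>q\<close>, both sides are constants times powers of \<open>r\<close>, so a bound
  for all \<open>r\<close> forces equal exponents.\<close>

lemma Iab_bounded_imp_homogeneity:
  fixes \<mu> \<alpha> \<beta> p q B :: real
  assumes pq: "1 < p" "p < q" and B: "0 < B"
    and bounded: "\<And>f :: 'n::finite heis \<Rightarrow> real. inLp p f \<Longrightarrow>
            (AE x in lborel. integrable lborel (\<lambda>y. f y * Vker \<alpha> \<beta> (hmul \<mu> x (hinv y)))) \<and>
            inLp q (Iab \<mu> \<alpha> \<beta> f) \<and>
            Lpnorm q (Iab \<mu> \<alpha> \<beta> f) \<le> B * Lpnorm p f"
  shows "(\<alpha> + \<beta>) / (real CARD('n) + 1) = 1 / p - 1 / q"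
proof -
  define n where "n = real CARD('n)"
  have n: "0 < n + 1" by (simp add: n_def add_nonneg_pos)
  \<comment> \<open>The homogeneous dimension: Lebesgue measure scales by \<open>r powr Q\<close>
    under \<open>hdil r\<close>.\<close>
  define Q where "Q = 2 * (n + 1)"
  define K where "K x y = Vker \<alpha> \<beta> (hmul \<mu> x (hinv y))" for x y :: "'n heis"
  have Km [measurable]: "(\<lambda>(x, y). K x y) \<in> borel_measurable (borel \<Otimes>\<^sub>M borel)"
    unfolding K_def by measurable
  define f0 where "f0 = (indicator (ball 0 1) :: 'n heis \<Rightarrow> real)"
  have f0m [measurable]: "f0 \<in> borel_measurable borel" unfolding f0_def by (intro borel_measurable_indicator) auto
  define f where "f r x = f0 (hdil r x)" for r x
  have fm [measurable]: "f r \<in> borel_measurable borel" for r unfolding f_def by measurable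
  have f_nonneg: "0 \<le> f r x" for r x by (simp add: f_def f0_def)
  \<comment> \<open>The operator with values in \<open>ennreal\<close>: it can be rescaled at every
    point without asking whether the integral converges.\<close>
  define J where "J g x = (\<integral>\<^sup>+y. ennreal (g y * K x y) \<partial>lborel)" for g :: "'n heis \<Rightarrow> real" and x
  have Jm [measurable]: "J f0 \<in> borel_measurable borel" unfolding J_def by measurable
  define X where "X = (\<integral>\<^sup>+x. epowr (J f0 x) q \<partial>lborel)"
  define y0 where "y0 = measure lborel (ball (0 :: 'n heis) 1)"

  have Kr: "K x y = r powr (- 2 * (\<alpha> + \<beta> - n - 1)) * K (hdil r x) (hdil r y)" if "0 < r" for r x y
    unfolding K_def hmul_hinv_hdil using that
    by (simp add: Vker_hdil n_def flip: powr_add mult.assoc)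
  have Jr: "J (f r) x = ennreal (r powr (- 2 * (\<alpha> + \<beta>))) * J f0 (hdil r x)" if r: "0 < r" for r x
  proof -
    have "J (f r) x = (\<integral>\<^sup>+y. ennreal (r powr (- 2 * (\<alpha> + \<beta> - n - 1))) * ennreal (f0 (hdil r y) * K (hdil r x) (hdil r y)) \<partial>lborel)"
      unfolding J_def f_def by (subst Kr[OF r]) (simp add: mult.left_commute flip: ennreal_mult')
    also have "\<dots> = ennreal (r powr (- 2 * (\<alpha> + \<beta> - n - 1))) * (\<integral>\<^sup>+y. ennreal (f0 (hdil r y) * K (hdil r x) (hdil r y)) \<partial>lborel)"
      by (intro nn_integral_cmult) measurable
    also have "(\<integral>\<^sup>+y. ennreal (f0 (hdil r y) * K (hdil r x) (hdil r y)) \<partial>lborel) = ennreal (r powr (- Q)) * J f0 (hdil r x)"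
      unfolding J_def using nn_integral_lborel_hdil[OF _ r, of "\<lambda>y. ennreal (f0 y * K (hdil r x) y)"]
      by (simp add: Q_def n_def)
    also have "ennreal (r powr (- 2 * (\<alpha> + \<beta> - n - 1))) * (ennreal (r powr (- Q)) * J f0 (hdil r x))
        = ennreal (r powr (- 2 * (\<alpha> + \<beta> - n - 1) + - Q)) * J f0 (hdil r x)"
      by (simp only: powr_add ennreal_mult powr_ge_zero mult.assoc)
    also have "- 2 * (\<alpha> + \<beta> - n - 1) + - Q = - 2 * (\<alpha> + \<beta>)" by (simp add: Q_def)
    finally show ?thesis .
  qed
  have JX: "(\<integral>\<^sup>+x. epowr (J (f r) x) q \<partial>lborel) = ennreal (r powr (- 2 * (\<alpha> + \<beta>) * q - Q)) * X" if r: "0 < r" for r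
  proof -
    have "(\<integral>\<^sup>+x. epowr (J (f r) x) q \<partial>lborel)
        = (\<integral>\<^sup>+x. ennreal (r powr (- 2 * (\<alpha> + \<beta>) * q)) * epowr (J f0 (hdil r x)) q \<partial>lborel)"
      by (simp add: Jr[OF r] epowr_mult epowr_ennreal powr_powr)
    also have "\<dots> = ennreal (r powr (- 2 * (\<alpha> + \<beta>) * q)) * (\<integral>\<^sup>+x. epowr (J f0 (hdil r x)) q \<partial>lborel)"
      by (intro nn_integral_cmult) measurable
    also have "(\<integral>\<^sup>+x. epowr (J f0 (hdil r x)) q \<partial>lborel) = ennreal (r powr (- Q)) * X"
      unfolding X_def using nn_integral_lborel_hdil[OF _ r, of "\<lambda>x. epowr (J f0 x) q"]
      by (simp add: Q_def n_def)
    finally show ?thesis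
      by (simp add: powr_diff powr_minus divide_inverse ennreal_mult mult.assoc)
  qed
  have fp: "(\<integral>\<^sup>+x. ennreal (\<bar>f r x\<bar> powr p) \<partial>lborel) = ennreal (r powr (- Q) * y0)" if r: "0 < r" for r
  proof -
    have "(\<integral>\<^sup>+x. ennreal (\<bar>f0 x\<bar> powr p) \<partial>lborel) = (\<integral>\<^sup>+x. indicator (ball 0 1) x \<partial>(lborel :: 'n heis measure))"
      by (intro nn_integral_cong) (auto simp: f0_def split: split_indicator)
    also have "\<dots> = ennreal y0"
      using emeasure_lborel_ball_finite[of "0 :: 'n heis" 1]
      by (simp add: y0_def emeasure_eq_ennreal_measure less_top)
    finally show ?thesis
      using nn_integral_lborel_hdil[OF _ r, of "\<lambda>x. ennreal (\<bar>f0 x\<bar> powr p)"]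
      by (simp add: f_def Q_def n_def ennreal_mult y0_def)
  qed
  have main: "ennreal (r powr (- 2 * (\<alpha> + \<beta>) * q - Q)) * X \<le> ennreal (B powr q * y0 powr (q / p) * r powr (- Q * q / p))"
    if r: "0 < r" for r
  proof -
    have fi: "integrable lborel (\<lambda>x. \<bar>f r x\<bar> powr p)"
      using fp[OF r] by (intro integrableI_bounded) auto
    then have "inLp p (f r)" by (simp add: inLp_def)
    from bounded[OF this]
    have int: "AE x in lborel. integrable lborel (\<lambda>y. f r y * K x y)" and Iq: "inLp q (Iab \<mu> \<alpha> \<beta> (f r))"
      and le: "Lpnorm q (Iab \<mu> \<alpha> \<beta> (f r)) \<le> B * Lpnorm p (f r)"
      by (auto simp: K_def)
    have "ennreal (\<integral>x. \<bar>f r x\<bar> powr p \<partial>lborel) = ennreal (r powr (- Q) * y0)"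
      using fp[OF r] fi by (simp add: nn_integral_eq_integral)
    then have Lp: "Lpnorm p (f r) = (r powr (- Q) * y0) powr (1 / p)"
      by (simp add: Lpnorm_def y0_def)
    \<comment> \<open>As \<open>f r\<close> and the kernel are nonnegative, \<open>J\<close> agrees
      with the operator wherever the integral converges, hence almost everywhere by the assumed
      boundedness.\<close>
    have "AE x in lborel. epowr (J (f r) x) q = ennreal (\<bar>Iab \<mu> \<alpha> \<beta> (f r) x\<bar> powr q)"
      using int
    proof eventually_elim
      case (elim x)
      have "J (f r) x = ennreal (Iab \<mu> \<alpha> \<beta> (f r) x)"
        using elim f_nonneg unfolding J_def Iab_def K_def[symmetric]
        by (intro nn_integral_eq_integral) (auto simp: K_def)
      moreover have "0 \<le> Iab \<mu> \<alpha> \<beta> (f r) x"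
        using f_nonneg unfolding Iab_def by (intro integral_nonneg_AE) auto
      ultimately show ?case by (simp add: epowr_ennreal)
    qed
    then have "(\<integral>\<^sup>+x. epowr (J (f r) x) q \<partial>lborel) = (\<integral>\<^sup>+x. ennreal (\<bar>Iab \<mu> \<alpha> \<beta> (f r) x\<bar> powr q) \<partial>lborel)"
      by (intro nn_integral_cong_AE)
    also have "\<dots> = ennreal (\<integral>x. \<bar>Iab \<mu> \<alpha> \<beta> (f r) x\<bar> powr q \<partial>lborel)"
      using Iq by (intro nn_integral_eq_integral) (auto simp: inLp_def)
    also have "(\<integral>x. \<bar>Iab \<mu> \<alpha> \<beta> (f r) x\<bar> powr q \<partial>lborel) = Lpnorm q (Iab \<mu> \<alpha> \<beta> (f r)) powr q"
      using pq by (simp add: Lpnorm_def powr_powr)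
    also have "\<dots> \<le> (B * Lpnorm p (f r)) powr q"
      using le pq by (intro powr_mono2) (auto simp: Lpnorm_def)
    also have "\<dots> = B powr q * y0 powr (q / p) * r powr (- Q * q / p)"
      using B r by (simp add: Lp powr_mult powr_powr y0_def)
    finally show ?thesis using JX[OF r] by (simp add: ennreal_leI)
  qed
  \<comment> \<open>The case \<open>r = 1\<close> shows that \<open>X\<close> is finite. With
    \<open>X\<close> also nonzero, it can be divided out for all other \<open>r\<close>.\<close>
  have "X \<le> ennreal (B powr q * y0 powr (q / p))" using main[of 1] by simp
  then obtain X' where X': "X = ennreal X'" "0 \<le> X'" by (cases X) (auto simp: top_unique)
  have "X \<noteq> 0"
  proof
    assume "X = 0"
    then have "AE x in lborel. epowr (J f0 x) q = 0"
      unfolding X_def by (subst (asm) nn_integral_0_iff_AE) auto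
    then show False
      using nn_integral_Vker_ball_pos[where 'n='n and \<alpha>=\<alpha> and \<beta>=\<beta> and \<mu>=\<mu>] unfolding J_def f0_def K_def by simp
  qed
  then have X'pos: "0 < X'" using X' by (cases "X' = 0") auto
  \<comment> \<open>The exponent of \<open>r\<close> left after all powers of \<open>r\<close> in
    \<open>main\<close> are moved to the left-hand side.\<close>
  define E where "E = - 2 * (\<alpha> + \<beta>) * q - Q + Q * q / p"
  have "r powr E \<le> B powr q * y0 powr (q / p) / X'" if r: "0 < r" for r
  proof -
    have "r powr (- 2 * (\<alpha> + \<beta>) * q - Q) * X' \<le> B powr q * y0 powr (q / p) * r powr (- Q * q / p)"
      using main[OF r] X' by (simp flip: ennreal_mult)
    then have "r powr (- 2 * (\<alpha> + \<beta>) * q - Q) * X' * r powr (Q * q / p)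
        \<le> B powr q * y0 powr (q / p) * r powr (- Q * q / p) * r powr (Q * q / p)"
      by (intro mult_right_mono) auto
    also have "\<dots> = B powr q * y0 powr (q / p)" using r by (simp add: mult.assoc flip: powr_add)
    also have "r powr (- 2 * (\<alpha> + \<beta>) * q - Q) * X' * r powr (Q * q / p) = r powr E * X'"
      by (simp add: E_def powr_add mult_ac)
    finally show ?thesis using X'pos by (simp add: field_simps)
  qed
  then have "E = 0" by (rule powr_bounded_imp_zero)
  moreover have "E = 2 * ((n + 1) * q / p - (n + 1) - (\<alpha> + \<beta>) * q)"
    by (simp add: E_def Q_def algebra_simps add_divide_distrib diff_divide_distrib)
  ultimately have "(\<alpha> + \<beta>) * q = (n + 1) * q / p - (n + 1)" by simp
  moreover have "(\<alpha> + \<beta>) / (n + 1) = ((\<alpha> + \<beta>) * q) / ((n + 1) * q)" using pq by simp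
  ultimately have "(\<alpha> + \<beta>) / (n + 1) = ((n + 1) * q / p - (n + 1)) / ((n + 1) * q)" by simp
  also have "\<dots> = 1 / p - 1 / q" using n pq by (simp add: diff_divide_distrib)
  finally have "(\<alpha> + \<beta>) / (n + 1) = 1 / p - 1 / q" .
  then show ?thesis by (simp add: n_def)
qed

theorem mainTheorem1:
  fixes \<mu> \<alpha> \<beta> p q :: real
  assumes "1 < p" and "p < q"
  shows "(\<exists>B>0. \<forall>f :: 'n::finite heis \<Rightarrow> real. inLp p f \<longrightarrow>
            (AE x in lborel. integrable lborel (\<lambda>y. f y * Vker \<alpha> \<beta> (hmul \<mu> x (hinv y)))) \<and>
            inLp q (Iab \<mu> \<alpha> \<beta> f) \<and>
            Lpnorm q (Iab \<mu> \<alpha> \<beta> f) \<le> B * Lpnorm p f)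
         \<longleftrightarrow> (\<alpha> + \<beta>) / (real CARD('n) + 1) = 1 / p - 1 / q"
proof
  assume "\<exists>B>0. \<forall>f :: 'n heis \<Rightarrow> real. inLp p f \<longrightarrow>
            (AE x in lborel. integrable lborel (\<lambda>y. f y * Vker \<alpha> \<beta> (hmul \<mu> x (hinv y)))) \<and>
            inLp q (Iab \<mu> \<alpha> \<beta> f) \<and>
            Lpnorm q (Iab \<mu> \<alpha> \<beta> f) \<le> B * Lpnorm p f"
  then show "(\<alpha> + \<beta>) / (real CARD('n) + 1) = 1 / p - 1 / q"
    using Iab_bounded_imp_homogeneity[OF assms, where 'n='n and \<alpha>=\<alpha> and \<beta>=\<beta> and \<mu>=\<mu>] by blast
qed (rule Iab_bounded[OF assms])

end
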